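(* Assume the following. (A1) $Q$ is positive semidefinite, each $g_i$ ($i=1,\dots,m$) is a proper closed convex function, and there exists a pair $(x^*,\lambda^* )$ satisfying the KKT conditions $0\in\partial F(x^* )-A^\top\lambda^*$ and $Ax^*-b=0$. (A2) For every $i$ (at every iteration), the solution set of the $x_i$-subproblem of the algorithm described in the context is nonempty. (A3) The mixing matrix $W=(w_{ij})\in\mathbb{R}^{m\times m}$ satisfies $w_{ij}=1$ for all $j\ge i$, and $u\in\mathbb{R}^m$ is a vector such that $U=W-eu^\top$ is symmetric, where $e\in\mathbb{R}^m$ is the all-one vector. Let $\{(x^k,\lambda^k)\}_{k\ge1}$ be any sequence generated by the algorithm (with $\lambda^1=0$) with parameters satisfying $$\beta\ge\rho>0,$$ $$\hat P:=P-D_H^\top\big((W-eu^\top+\alpha uu^\top)\otimes I\big)D_H-\beta D_A^\top\big((W-eu^\top+\alpha uu^\top)\otimes I\big)D_A\succeq 0,$$ where $\alpha\ge1$. For $t\ge1$ let $\bar x^{t+1}=\frac1t\sum_{k=1}^t x^{k+1}$. Then for every $t\ge 1$ and every point $(x^*,\lambda^* )$ satisfying the KKT conditions, with $y^*=D_Hx^*$, $z^*=D_Ax^*$, $$\big|F(\bar x^{t+1})-F(x^* )\big|\le\frac1{2t}\left(\frac{\max\{(1+\|\lambda^*\|)^2,4\|\lambda^*\|^2\}}{\rho}+\|x^1-x^*\|_P^2-\|y^1-y^*\|_V^2-\beta\|z^1-z^*\|_V^2\right),$$ $$\|A\bar x^{t+1}-b\|\le\frac1{2t}\left(\frac{\max\{(1+\|\lambda^*\|)^2,4\|\lambda^*\|^2\}}{\rho}+\|x^1-x^*\|_P^2-\|y^1-y^*\|_V^2-\beta\|z^1-z^*\|_V^2\right).$$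 In addition, if $\alpha>1$ and $\hat P\succ0$, then $(x^k,\lambda^k)$ converges to a point $(x^\infty,\lambda^\infty)$ that satisfies the KKT conditions, i.e. $0\in\partial F(x^\infty)-A^\top\lambda^\infty$ and $Ax^\infty=b$.
   Context: Problem: $\min_x \frac12x^\top Qx+\sum_{i=1}^m g_i(x_i)$ subject to $Ax=b$, where $x=(x_1,\dots,x_m)$ is partitioned into $m$ disjoint blocks (real vectors), $Q$ is a symmetric positive semidefinite matrix, and each $g_i$ is a proper closed convex, extended-real-valued, possibly nondifferentiable function. Write $f(x)=\frac12x^\top Qx$, $g(x)=\sum_{i=1}^m g_i(x_i)$, $F=f+g$. $\partial F$ is the convex subdifferential; $\nabla_i f$ is the partial gradient with respect to block $x_i$. Write $A=(A_1,\dots,A_m)$ for the column-block partition of $A$ corresponding to that of $x$. Let $H$ be a matrix with $Q=H^\top H$, partitioned correspondingly as $H=(H_1,\dots,H_m)$. $\|\cdot\|$ is the Euclidean norm; for a symmetric matrix $S$ (not necessarily positive semidefinite), $\|v\|_S^2:=v^\top Sv$. $\otimes$ is the Kronecker product, and $I$ is an identity matrix whose size is determined by context (the number of rows of $H$ or of $A$, respectively). Algorithm: choose $x^1$ and set $\lambda^1=0$; choose $\beta,\rho$, an $m\times m$ matrix $W=(w_{ij})$, and symmetric positive semidefinite matrices $P_1,\dots,P_m$. For $k=1,2,\dots$: for $i=1,2,\dots,m$ in order, choose $$x_i^{k+1}\in\arg\min_{x_i}\ \Big\langle\nabla_if(\hat x^{k,i})-A_i^\top\big(\lambda^k-\beta(A\hat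 x^{k,i}-b)\big),x_i\Big\rangle+g_i(x_i)+\frac12\|x_i-x_i^k\|_{P_i}^2,$$ where $\hat x^{k,i}$ has blocks $\hat x_j^{k,i}=x_j^{k+1}-w_{ij}(x_j^{k+1}-x_j^k)$ for $j=1,\dots,m$ (when $w_{ij}=1$ this is $x_j^k$, so with $w_{ij}=1$ for $j\ge i$ only already computed blocks are used); then set $\lambda^{k+1}=\lambda^k-\rho(Ax^{k+1}-b)$. (The algorithm is considered as running indefinitely.) Further notation: $P=\mathrm{blkdiag}(P_1,\dots,P_m)$, $D_H=\mathrm{blkdiag}(H_1,\dots,H_m)$, $D_A=\mathrm{blkdiag}(A_1,\dots,A_m)$; $y=D_Hx$ and $z=D_Ax$, i.e. $y_i=H_ix_i$, $z_i=A_ix_i$, with the same superscripts as on $x$ (e.g. $y^1=D_Hx^1$); $V=U\otimes I$ with $U=W-eu^\top$. *)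

theory Defs
  imports "HOL-Analysis.Analysis"
begin

text \<open>
  Encoding of the block structure.  The decision vector is \<open>x :: real ^ 'n\<close>, and a map
  \<open>blk :: 'n \<Rightarrow> 'm\<close> assigns to every coordinate its block; \<open>'m\<close> is a finite linear order,
  standing for \<open>{1, \<dots>, m}\<close>.  The space of the block \<open>x\<^sub>i\<close> is identified with the
  coordinate subspace \<open>block_space blk i\<close> of \<open>real ^ 'n\<close>, so that blocks may have different
  dimensions.  Correspondingly \<open>A\<^sub>i\<close>, \<open>H\<^sub>i\<close> are zero-padded column blocks and
  \<open>P\<^sub>i\<close> is a matrix supported on the rows and columns of block \<open>i\<close>.
\<close>

definition block_space :: "('n::finite \<Rightarrow> 'm) \<Rightarrow> 'm \<Rightarrow> (real ^ 'n) set" where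
  "block_space blk i = {v. \<forall>c. blk c \<noteq> i \<longrightarrow> v $ c = 0}"

definition block :: "('n::finite \<Rightarrow> 'm) \<Rightarrow> 'm \<Rightarrow> real ^ 'n \<Rightarrow> real ^ 'n" where
  "block blk i x = (\<chi> c. if blk c = i then x $ c else 0)"

definition col_block :: "('n::finite \<Rightarrow> 'm) \<Rightarrow> 'm \<Rightarrow> real ^ 'n ^ 'p::finite \<Rightarrow> real ^ 'n ^ 'p" where
  "col_block blk i M = (\<chi> r c. if blk c = i then M $ r $ c else 0)"

definition block_supported :: "('n::finite \<Rightarrow> 'm) \<Rightarrow> 'm \<Rightarrow> real ^ 'n ^ 'n \<Rightarrow> bool" where
  "block_supported blk i M \<longleftrightarrow> (\<forall>c d. M $ c $ d \<noteq> 0 \<longrightarrow> blk c = i \<and> blk d = i)"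

text \<open>\<open>blkdiag blk P\<close> is \<open>blkdiag(P\<^sub>1, \<dots>, P\<^sub>m)\<close>.\<close>

definition blkdiag :: "('n::finite \<Rightarrow> 'm) \<Rightarrow> ('m \<Rightarrow> real ^ 'n ^ 'n) \<Rightarrow> real ^ 'n ^ 'n" where
  "blkdiag blk P = (\<chi> c d. if blk c = blk d then P (blk c) $ c $ d else 0)"

text \<open>
  \<open>blkdiag_cols blk M\<close> is \<open>blkdiag(M\<^sub>1, \<dots>, M\<^sub>m)\<close> for the column blocks of \<open>M\<close>: its row
  with index \<open>(i, r)\<close> is row \<open>r\<close> of \<open>M\<^sub>i\<close>.
\<close>

definition blkdiag_cols ::
    "('n::finite \<Rightarrow> 'm::finite) \<Rightarrow> real ^ 'n ^ 'p::finite \<Rightarrow> real ^ 'n ^ ('m \<times> 'p)" where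
  "blkdiag_cols blk M = (\<chi> ir c. col_block blk (fst ir) M $ snd ir $ c)"

definition kron ::
    "real ^ 'b ^ 'a \<Rightarrow> real ^ 'd ^ 'c \<Rightarrow> real ^ ('b::finite \<times> 'd::finite) ^ ('a::finite \<times> 'c::finite)" where
  "kron M N = (\<chi> ir js. M $ fst ir $ fst js * N $ snd ir $ snd js)"

definition outer :: "real ^ 'a \<Rightarrow> real ^ 'b \<Rightarrow> real ^ 'b::finite ^ 'a::finite" where
  "outer a b = (\<chi> i j. a $ i * b $ j)"

text \<open>\<open>qform S v\<close> is \<open>\<parallel>v\<parallel>\<^sub>S\<^sup>2 = v\<^sup>T S v\<close>; \<open>S\<close> need not be positive semidefinite.\<close>

definition qform :: "real ^ 'n ^ 'n \<Rightarrow> real ^ 'n::finite \<Rightarrow> real" where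
  "qform S v = v \<bullet> (S *v v)"

definition sym_mat :: "real ^ 'n ^ 'n::finite \<Rightarrow> bool" where
  "sym_mat S \<longleftrightarrow> transpose S = S"

definition psd :: "real ^ 'n ^ 'n::finite \<Rightarrow> bool" where
  "psd S \<longleftrightarrow> sym_mat S \<and> (\<forall>v. 0 \<le> qform S v)"

definition pd :: "real ^ 'n ^ 'n::finite \<Rightarrow> bool" where
  "pd S \<longleftrightarrow> sym_mat S \<and> (\<forall>v. v \<noteq> 0 \<longrightarrow> 0 < qform S v)"

text \<open>
  Extended-real-valued functions on a set \<open>S\<close>, which below is a block space; since that is
  a closed subset of \<open>real ^ 'n\<close>, closedness of the epigraph may be taken in the ambient space.
\<close>

definition epi_on :: "'a set \<Rightarrow> ('a \<Rightarrow> ereal) \<Rightarrow> ('a \<times> real) set" where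
  "epi_on S h = {(v, r). v \<in> S \<and> h v \<le> ereal r}"

definition proper_on :: "'a set \<Rightarrow> ('a \<Rightarrow> ereal) \<Rightarrow> bool" where
  "proper_on S h \<longleftrightarrow> (\<forall>v\<in>S. h v \<noteq> -\<infinity>) \<and> (\<exists>v\<in>S. h v \<noteq> \<infinity>)"

definition proper_closed_convex_on :: "'a::euclidean_space set \<Rightarrow> ('a \<Rightarrow> ereal) \<Rightarrow> bool" where
  "proper_closed_convex_on S h \<longleftrightarrow> proper_on S h \<and> closed (epi_on S h) \<and> convex (epi_on S h)"

definition subdifferential :: "('a::real_inner \<Rightarrow> ereal) \<Rightarrow> 'a \<Rightarrow> 'a set" where
  "subdifferential h x = {v. \<forall>y. h x + ereal (v \<bullet> (y - x)) \<le> h y}"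

definition f_obj :: "real ^ 'n ^ 'n \<Rightarrow> real ^ 'n::finite \<Rightarrow> real" where
  "f_obj Q x = 1 / 2 * (x \<bullet> (Q *v x))"

text \<open>Only the values of \<open>g i\<close> on \<open>block_space blk i\<close> are ever used.\<close>

definition F_obj ::
    "('n::finite \<Rightarrow> 'm::finite) \<Rightarrow> real ^ 'n ^ 'n \<Rightarrow> ('m \<Rightarrow> real ^ 'n \<Rightarrow> ereal) \<Rightarrow> real ^ 'n \<Rightarrow> ereal" where
  "F_obj blk Q g x = ereal (f_obj Q x) + (\<Sum>i\<in>UNIV. g i (block blk i x))"

definition KKT ::
    "('n::finite \<Rightarrow> 'm::finite) \<Rightarrow> real ^ 'n ^ 'n \<Rightarrow> ('m \<Rightarrow> real ^ 'n \<Rightarrow> ereal)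
      \<Rightarrow> real ^ 'n ^ 'q::finite \<Rightarrow> real ^ 'q \<Rightarrow> real ^ 'n \<Rightarrow> real ^ 'q \<Rightarrow> bool" where
  "KKT blk Q g A b x lam \<longleftrightarrow>
     0 \<in> (\<lambda>v. v - transpose A *v lam) ` subdifferential (F_obj blk Q g) x \<and> A *v x - b = 0"

definition grad :: "('a::real_inner \<Rightarrow> real) \<Rightarrow> 'a \<Rightarrow> 'a" where
  "grad h x = (THE D. GDERIV h x :> D)"

definition partial_grad ::
    "('n::finite \<Rightarrow> 'm) \<Rightarrow> 'm \<Rightarrow> (real ^ 'n \<Rightarrow> real) \<Rightarrow> real ^ 'n \<Rightarrow> real ^ 'n" where
  "partial_grad blk i h x = block blk i (grad h x)"

text \<open>\<open>xhat blk W i (x k) (x (Suc k))\<close> is the point written with a hat and superscript \<open>k,i\<close>.\<close>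

definition xhat ::
    "('n::finite \<Rightarrow> 'm::finite) \<Rightarrow> real ^ 'm ^ 'm \<Rightarrow> 'm \<Rightarrow> real ^ 'n \<Rightarrow> real ^ 'n \<Rightarrow> real ^ 'n" where
  "xhat blk W i xold xnew = (\<chi> c. xnew $ c - W $ i $ blk c * (xnew $ c - xold $ c))"

text \<open>
  The objective and the solution set of the \<open>x\<^sub>i\<close>-subproblem, with \<open>xh\<close> the point at which
  \<open>f\<close> and the residual are linearised and \<open>xold = x\<^sup>k\<close>.
\<close>

definition subproblem_obj ::
    "('n::finite \<Rightarrow> 'm::finite) \<Rightarrow> real ^ 'n ^ 'n \<Rightarrow> ('m \<Rightarrow> real ^ 'n \<Rightarrow> ereal)
      \<Rightarrow> real ^ 'n ^ 'q::finite \<Rightarrow> real ^ 'q \<Rightarrow> real \<Rightarrow> ('m \<Rightarrow> real ^ 'n ^ 'n)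
      \<Rightarrow> 'm \<Rightarrow> real ^ 'n \<Rightarrow> real ^ 'n \<Rightarrow> real ^ 'q \<Rightarrow> real ^ 'n \<Rightarrow> ereal" where
  "subproblem_obj blk Q g A b \<beta> P i xh xold lam v =
     ereal ((partial_grad blk i (f_obj Q) xh
             - transpose (col_block blk i A) *v (lam - \<beta> *\<^sub>R (A *v xh - b))) \<bullet> v)
     + g i v + ereal (1 / 2 * qform (P i) (v - block blk i xold))"

definition subproblem_sols ::
    "('n::finite \<Rightarrow> 'm::finite) \<Rightarrow> real ^ 'n ^ 'n \<Rightarrow> ('m \<Rightarrow> real ^ 'n \<Rightarrow> ereal)
      \<Rightarrow> real ^ 'n ^ 'q::finite \<Rightarrow> real ^ 'q \<Rightarrow> real \<Rightarrow> ('m \<Rightarrow> real ^ 'n ^ 'n)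
      \<Rightarrow> 'm \<Rightarrow> real ^ 'n \<Rightarrow> real ^ 'n \<Rightarrow> real ^ 'q \<Rightarrow> (real ^ 'n) set" where
  "subproblem_sols blk Q g A b \<beta> P i xh xold lam =
     {v. is_arg_min (subproblem_obj blk Q g A b \<beta> P i xh xold lam) (\<lambda>v. v \<in> block_space blk i) v}"

text \<open>
  Sequences are indexed from 1; the values at index 0 play no role.  The order in which the blocks
  are updated enters through \<open>xhat\<close>: if \<open>W $ i $ j = 1\<close> for \<open>j \<ge> i\<close>, only the blocks
  \<open>j < i\<close> of \<open>x (Suc k)\<close> occur in the subproblem for block \<open>i\<close>.
\<close>

definition generated ::
    "('n::finite \<Rightarrow> 'm::finite) \<Rightarrow> real ^ 'n ^ 'n \<Rightarrow> ('m \<Rightarrow> real ^ 'n \<Rightarrow> ereal)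
      \<Rightarrow> real ^ 'n ^ 'q::finite \<Rightarrow> real ^ 'q \<Rightarrow> real \<Rightarrow> real \<Rightarrow> real ^ 'm ^ 'm \<Rightarrow> ('m \<Rightarrow> real ^ 'n ^ 'n)
      \<Rightarrow> (nat \<Rightarrow> real ^ 'n) \<Rightarrow> (nat \<Rightarrow> real ^ 'q) \<Rightarrow> bool" where
  "generated blk Q g A b \<beta> \<rho> W P x lam \<longleftrightarrow>
     lam 1 = 0 \<and>
     (\<forall>k\<ge>1.
        (\<forall>i. block blk i (x (Suc k)) \<in>
               subproblem_sols blk Q g A b \<beta> P i (xhat blk W i (x k) (x (Suc k))) (x k) (lam k)) \<and>
        lam (Suc k) = lam k - \<rho> *\<^sub>R (A *v x (Suc k) - b))"

definition U_mat :: "real ^ 'm ^ 'm \<Rightarrow> real ^ 'm \<Rightarrow> real ^ 'm ^ 'm::finite" where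
  "U_mat W u = W - outer (vec 1) u"

definition P_hat ::
    "('n::finite \<Rightarrow> 'm::finite) \<Rightarrow> real ^ 'n ^ 'p::finite \<Rightarrow> real ^ 'n ^ 'q::finite
      \<Rightarrow> ('m \<Rightarrow> real ^ 'n ^ 'n) \<Rightarrow> real ^ 'm ^ 'm \<Rightarrow> real ^ 'm \<Rightarrow> real \<Rightarrow> real \<Rightarrow> real ^ 'n ^ 'n" where
  "P_hat blk H A P W u \<alpha> \<beta> =
     blkdiag blk P
     - transpose (blkdiag_cols blk H)
         ** kron (W - outer (vec 1) u + \<alpha> *\<^sub>R outer u u) (mat 1 :: real ^ 'p ^ 'p)
         ** blkdiag_cols blk H
     - \<beta> *\<^sub>R (transpose (blkdiag_cols blk A)
         ** kron (W - outer (vec 1) u + \<alpha> *\<^sub>R outer u u) (mat 1 :: real ^ 'q ^ 'q)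
         ** blkdiag_cols blk A)"

text \<open>
  The bracket on the right-hand sides of the rate estimates, with
  \<open>y = D\<^sub>H x\<close>, \<open>z = D\<^sub>A x\<close> and \<open>V = U \<otimes> I\<close>.
\<close>

definition rate_const ::
    "('n::finite \<Rightarrow> 'm::finite) \<Rightarrow> real ^ 'n ^ 'p::finite \<Rightarrow> real ^ 'n ^ 'q::finite
      \<Rightarrow> ('m \<Rightarrow> real ^ 'n ^ 'n) \<Rightarrow> real ^ 'm ^ 'm \<Rightarrow> real ^ 'm \<Rightarrow> real \<Rightarrow> real
      \<Rightarrow> real ^ 'n \<Rightarrow> real ^ 'n \<Rightarrow> real ^ 'q \<Rightarrow> real" where
  "rate_const blk H A P W u \<beta> \<rho> x1 xs ls =
     max ((1 + norm ls)\<^sup>2) (4 * (norm ls)\<^sup>2) / \<rho>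
     + qform (blkdiag blk P) (x1 - xs)
     - qform (kron (U_mat W u) (mat 1 :: real ^ 'p ^ 'p)) (blkdiag_cols blk H *v x1 - blkdiag_cols blk H *v xs)
     - \<beta> * qform (kron (U_mat W u) (mat 1 :: real ^ 'q ^ 'q)) (blkdiag_cols blk A *v x1 - blkdiag_cols blk A *v xs)"

end

theory Submission
  imports Defs
begin

text \<open>
  Summing the variational inequalities of the block subproblems and writing \<open>W = U + e u\<^sup>T\<close>, the
  symmetric matrix \<open>U\<close> merges with the proximal terms into the single symmetric form
  \<open>S = P - D\<^sub>H\<^sup>T V D\<^sub>H - \<beta> D\<^sub>A\<^sup>T V D\<^sub>A\<close>, while \<open>e u\<^sup>T\<close> only pairs \<open>\<Sum>\<^sub>j u\<^sub>j H\<^sub>j d\<^sub>j\<close> and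
  \<open>\<Sum>\<^sub>j u\<^sub>j A\<^sub>j d\<^sub>j\<close>, where \<open>d = x\<^sup>k\<^sup>+\<^sup>1 - x\<^sup>k\<close>, with \<open>H (x\<^sup>k\<^sup>+\<^sup>1 - x)\<close> and the residual. The
  terms \<open>\<alpha> u u\<^sup>T\<close> in \<open>P_hat\<close> complete these pairings to squares, so
  \<open>\<parallel>\<lambda>\<^sup>k - \<mu>\<parallel>\<^sup>2 / \<rho> + \<parallel>x\<^sup>k - x\<parallel>\<^sub>S\<^sup>2\<close> decreases by at least twice the Lagrangian gap, for every
  feasible \<open>x\<close> and every multiplier \<open>\<mu>\<close>. The rates follow by averaging and choosing
  \<open>\<mu>\<close> antiparallel to the averaged residual. If \<open>P_hat\<close> is positive definite, the increments and
  residuals vanish, every cluster point is a KKT point, and the Lyapunov function centred at a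
  cluster point is monotone and tends to 0 along a subsequence, hence tends to 0.
\<close>

section \<open>Block linear algebra\<close>

lemma block_in_block_space: "block blk i x \<in> block_space blk i"
  by (simp add: block_def block_space_def)

lemma block_eq_self: "v \<in> block_space blk i \<Longrightarrow> block blk i v = v"
  by (auto simp: block_def block_space_def vec_eq_iff)

lemma block_add: "block blk i (x + y) = block blk i x + block blk i y"
  by (simp add: block_def vec_eq_iff)

lemma block_diff: "block blk i (x - y) = block blk i x - block blk i y"
  by (simp add: block_def vec_eq_iff)

lemma block_scaleR: "block blk i (r *\<^sub>R x) = r *\<^sub>R block blk i x"
  by (simp add: block_def vec_eq_iff)

lemma linear_block: "linear (block blk i)"
  by (rule linearI) (simp_all add: block_add block_scaleR)

lemma block_block: "block blk i (block blk i x) = block blk i x"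
  by (simp add: block_eq_self block_in_block_space)

lemma sum_block:
  fixes blk :: "'n::finite \<Rightarrow> 'm::finite"
  shows "(\<Sum>i\<in>UNIV. block blk i x) = x"
  by (simp add: vec_eq_iff block_def)

lemma inner_block: "block blk i x \<bullet> y = x \<bullet> block blk i y"
  by (auto simp: inner_vec_def block_def intro!: sum.cong)

lemma transpose_col_block_mult: "transpose (col_block blk i M) *v y = block blk i (transpose M *v y)"
  by (auto simp: vec_eq_iff matrix_vector_mult_def col_block_def block_def transpose_def intro!: sum.cong)

lemma inner_transpose_mult:
  fixes M :: "real ^ 'n ^ 'p"
  shows "(transpose M *v y) \<bullet> x = y \<bullet> (M *v x)"
  by (simp add: dot_lmul_matrix)

lemma mult_eq_sum_block:
  fixes blk :: "'n::finite \<Rightarrow> 'm::finite" and M :: "real ^ 'n ^ 'p"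
  shows "M *v x = (\<Sum>i\<in>UNIV. M *v block blk i x)"
  by (metis sum_block linear_sum matrix_vector_mul_linear)

lemma blkdiag_cols_mult:
  fixes blk :: "'n::finite \<Rightarrow> 'm::finite"
  shows "(blkdiag_cols blk M *v x) $ ir = (M *v block blk (fst ir) x) $ snd ir"
  by (auto simp: matrix_vector_mult_def blkdiag_cols_def col_block_def block_def intro!: sum.cong)

text \<open>The identity factor of \<open>kron\<close> collapses the sum over the inner row index,
  so a product with \<open>V\<close> becomes a double sum over pairs of blocks. All later work with
  Kronecker products goes through this form.\<close>

lemma inner_kron_mat_1:
  fixes blk :: "'n::finite \<Rightarrow> 'm::finite" and K :: "real ^ 'm ^ 'm"
    and M :: "real ^ 'n ^ 'p::finite"
  shows "(blkdiag_cols blk M *v a) \<bullet> (kron K (mat 1 :: real ^ 'p ^ 'p) *v (blkdiag_cols blk M *v c))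
    = (\<Sum>i\<in>UNIV. \<Sum>j\<in>UNIV. K $ i $ j * ((M *v block blk i a) \<bullet> (M *v block blk j c)))"
proof -
  have *: "(kron K (mat 1 :: real ^ 'p ^ 'p) *v (blkdiag_cols blk M *v c)) $ (i, r)
     = (\<Sum>j\<in>UNIV. K $ i $ j * (M *v block blk j c) $ r)" for i r
  proof -
    have "(kron K (mat 1 :: real ^ 'p ^ 'p) *v (blkdiag_cols blk M *v c)) $ (i, r)
      = (\<Sum>js\<in>UNIV \<times> UNIV. K $ i $ fst js * (mat 1 :: real ^ 'p ^ 'p) $ r $ snd js
           * (M *v block blk (fst js) c) $ snd js)"
      by (subst matrix_vector_mult_def) (simp add: kron_def blkdiag_cols_mult)
    also have "\<dots> = (\<Sum>j\<in>UNIV. \<Sum>s\<in>UNIV. K $ i $ j * (mat 1 :: real ^ 'p ^ 'p) $ r $ s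
           * (M *v block blk j c) $ s)"
      by (simp add: sum.cartesian_product case_prod_beta)
    also have "\<dots> = (\<Sum>j\<in>UNIV. K $ i $ j * (M *v block blk j c) $ r)"
      by (intro sum.cong refl) (simp add: mat_def if_distrib if_distribR cong: if_cong)
    finally show ?thesis .
  qed
  have "(blkdiag_cols blk M *v a) \<bullet> (kron K (mat 1 :: real ^ 'p ^ 'p) *v (blkdiag_cols blk M *v c))
    = (\<Sum>ir\<in>UNIV \<times> UNIV. (M *v block blk (fst ir) a) $ snd ir *
         (\<Sum>j\<in>UNIV. K $ fst ir $ j * (M *v block blk j c) $ snd ir))"
    by (simp add: inner_vec_def blkdiag_cols_mult flip: *)
  also have "\<dots> = (\<Sum>i\<in>UNIV. \<Sum>r\<in>UNIV. \<Sum>j\<in>UNIV. K $ i $ j *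
         ((M *v block blk i a) $ r * (M *v block blk j c) $ r))"
    by (simp only: sum.cartesian_product' fst_conv snd_conv sum_distrib_left mult.left_commute)
  also have "\<dots> = (\<Sum>i\<in>UNIV. \<Sum>j\<in>UNIV. \<Sum>r\<in>UNIV. K $ i $ j *
         ((M *v block blk i a) $ r * (M *v block blk j c) $ r))"
    by (intro sum.cong refl sum.swap)
  finally show ?thesis
    by (simp add: inner_vec_def sum_distrib_left)
qed

text \<open>On the rows of block \<open>i\<close>, \<open>P i\<close> applied to block
  \<open>i\<close> of \<open>c\<close> agrees with the block diagonal matrix applied to
  \<open>c\<close>, and the blocks of \<open>a\<close> add up to \<open>a\<close>.\<close>

lemma inner_blkdiag:
  fixes blk :: "'n::finite \<Rightarrow> 'm::finite"
  shows "a \<bullet> (blkdiag blk P *v c) = (\<Sum>i\<in>UNIV. block blk i a \<bullet> (P i *v block blk i c))"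
proof -
  have "(P i *v block blk i c) $ r = (blkdiag blk P *v c) $ r" if "blk r = i" for i r
    using that by (auto simp: matrix_vector_mult_def blkdiag_def block_def intro!: sum.cong)
  then have "block blk i a \<bullet> (P i *v block blk i c) = block blk i a \<bullet> (blkdiag blk P *v c)" for i
    by (auto simp: inner_vec_def block_def intro!: sum.cong)
  then show ?thesis
    by (simp add: sum_block flip: inner_sum_left)
qed

lemma xhat_eq:
  fixes blk :: "'n::finite \<Rightarrow> 'm::finite"
  shows "xhat blk W i x0 x1 = x1 - (\<Sum>j\<in>UNIV. W $ i $ j *\<^sub>R block blk j (x1 - x0))"
  by (simp add: vec_eq_iff xhat_def block_def if_distrib cong: if_cong)

lemma mult_xhat:
  fixes blk :: "'n::finite \<Rightarrow> 'm::finite" and M :: "real ^ 'n ^ 'p"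
  shows "M *v xhat blk W i x0 x1 = M *v x1 - (\<Sum>j\<in>UNIV. W $ i $ j *\<^sub>R (M *v block blk j (x1 - x0)))"
  unfolding xhat_eq matrix_vector_mult_diff_distrib
  by (simp add: linear_sum[OF matrix_vector_mul_linear] matrix_vector_mult_scaleR)

section \<open>Quadratic forms, limits and the gradient of \<open>f\<close>\<close>

lemma sym_mat_inner:
  assumes "sym_mat S"
  shows "(S *v a) \<bullet> c = a \<bullet> (S *v c)"
  using inner_transpose_mult[of S a c] assms unfolding sym_mat_def by metis

lemma qform_add:
  assumes "sym_mat S"
  shows "qform S (a + c) = qform S a + 2 * (a \<bullet> (S *v c)) + qform S c"
  using sym_mat_inner[OF assms, of a c]
  by (simp add: qform_def matrix_vector_right_distrib inner_add_left inner_add_right inner_commute)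

lemma qform_scaleR: "qform S (r *\<^sub>R a) = r\<^sup>2 * qform S a"
  by (simp add: qform_def matrix_vector_mult_scaleR power2_eq_square)

lemma qform_zero [simp]: "qform S 0 = 0"
  by (simp add: qform_def)

lemma continuous_on_mult_vec [continuous_intros]:
  fixes M :: "real ^ 'n ^ 'p"
  shows "continuous_on T f \<Longrightarrow> continuous_on T (\<lambda>x. M *v f x)"
  by (rule bounded_linear.continuous_on[OF matrix_vector_mul_bounded_linear])

lemma tendsto_mult_vec [tendsto_intros]:
  fixes M :: "real ^ 'n ^ 'p"
  shows "(f \<longlongrightarrow> l) T \<Longrightarrow> ((\<lambda>x. M *v f x) \<longlongrightarrow> M *v l) T"
  by (rule bounded_linear.tendsto[OF matrix_vector_mul_bounded_linear])

lemma tendsto_block [tendsto_intros]: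
  "(f \<longlongrightarrow> l) T \<Longrightarrow> ((\<lambda>x. block blk i (f x)) \<longlongrightarrow> block blk i l) T"
  by (rule bounded_linear.tendsto[OF linear_conv_bounded_linear[THEN iffD1, OF linear_block]])

text \<open>The modulus is the minimum of the form over the compact unit sphere; homogeneity of
  degree two extends the bound to all vectors.\<close>

lemma pd_lower_bound:
  fixes S :: "real ^ 'n ^ 'n::finite"
  assumes "pd S"
  obtains c where "c > 0" "\<And>v. c * (norm v)\<^sup>2 \<le> qform S v"
proof -
  have ne: "sphere (0 :: real ^ 'n) 1 \<noteq> {}" by simp
  have "continuous_on (sphere 0 1) (qform S)"
    unfolding qform_def by (intro continuous_intros)
  then obtain w where w: "w \<in> sphere 0 1" "\<And>v. v \<in> sphere 0 1 \<Longrightarrow> qform S w \<le> qform S v"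
    using continuous_attains_inf[OF compact_sphere ne] by blast
  show ?thesis
  proof
    have "w \<noteq> 0" using w(1) by auto
    then show "qform S w > 0" using assms by (simp add: pd_def)
    fix v :: "real ^ 'n"
    show "qform S w * (norm v)\<^sup>2 \<le> qform S v"
    proof (cases "v = 0")
      case False
      have "qform S w \<le> qform S ((1 / norm v) *\<^sub>R v)"
        by (rule w(2)) (use False in simp)
      then show ?thesis
        using False unfolding qform_scaleR by (simp add: field_simps)
    qed simp
  qed
qed

text \<open>Symmetry merges the two terms of the product rule. As \<open>grad\<close> is a definite
  description, uniqueness of the derivative has to be shown as well.\<close>

lemma grad_f_obj:
  assumes "sym_mat Q"
  shows "grad (f_obj Q) x = Q *v x"
proof -
  have "((\<lambda>x. 1 / 2 * (x \<bullet> (Q *v x))) has_derivative (\<lambda>h. 1 / 2 * (x \<bullet> (Q *v h) + h \<bullet> (Q *v x)))) (at x)"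
    by (intro derivative_intros bounded_linear.has_derivative[OF matrix_vector_mul_bounded_linear])
  moreover have "(\<lambda>h. 1 / 2 * (x \<bullet> (Q *v h) + h \<bullet> (Q *v x))) = (\<lambda>h. h \<bullet> (Q *v x))"
    using sym_mat_inner[OF assms, of x] by (auto simp: inner_commute)
  moreover have "f_obj Q = (\<lambda>x. 1 / 2 * (x \<bullet> (Q *v x)))"
    by (simp add: f_obj_def fun_eq_iff)
  ultimately have D: "GDERIV (f_obj Q) x :> Q *v x"
    by (simp only: gderiv_def)
  show ?thesis
    unfolding grad_def
  proof (rule the_equality, rule D)
    fix D' assume "GDERIV (f_obj Q) x :> D'"
    then have "(\<lambda>h. h \<bullet> D') = (\<lambda>h. h \<bullet> (Q *v x))"
      using D has_derivative_unique unfolding gderiv_def by blast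
    then show "D' = Q *v x"
      by (metis vector_eq_ldot)
  qed
qed

section \<open>Convexity and variational inequalities\<close>

text \<open>Convexity of the epigraph is applied to the graph points over \<open>v\<close> and
  \<open>w\<close>; these have real heights because properness excludes
  \<open>-\<infinity>\<close>.\<close>

lemma proper_closed_convex_on_imp_convex_on:
  assumes h: "proper_closed_convex_on S h"
  shows "convex_on {v \<in> S. h v \<noteq> \<infinity>} (\<lambda>v. real_of_ereal (h v))"
proof -
  have fin: "ereal (real_of_ereal (h v)) = h v" if "v \<in> S" "h v \<noteq> \<infinity>" for v
    using h that by (auto simp: proper_closed_convex_on_def proper_on_def ereal_real)
  have key: "p *\<^sub>R v + q *\<^sub>R w \<in> S \<and> h (p *\<^sub>R v + q *\<^sub>R w) \<le> ereal (p * real_of_ereal (h v) + q * real_of_ereal (h w))"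
    if "v \<in> S" "h v \<noteq> \<infinity>" "w \<in> S" "h w \<noteq> \<infinity>" "0 \<le> p" "0 \<le> q" "p + q = 1" for p q v w
  proof -
    have "(v, real_of_ereal (h v)) \<in> epi_on S h" "(w, real_of_ereal (h w)) \<in> epi_on S h"
      using that fin by (auto simp: epi_on_def)
    then have "p *\<^sub>R (v, real_of_ereal (h v)) + q *\<^sub>R (w, real_of_ereal (h w)) \<in> epi_on S h"
      using h that unfolding proper_closed_convex_on_def convex_def by blast
    then show ?thesis by (simp add: epi_on_def)
  qed
  have mem: "p *\<^sub>R v + q *\<^sub>R w \<in> {v \<in> S. h v \<noteq> \<infinity>}"
    if "v \<in> {v \<in> S. h v \<noteq> \<infinity>}" "w \<in> {v \<in> S. h v \<noteq> \<infinity>}" "0 \<le> p" "0 \<le> q" "p + q = 1" for p q v w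
    using key[of v w p q] that by auto
  show ?thesis
    unfolding convex_on_def convex_def
  proof (intro conjI allI ballI impI mem)
    fix v w and p q :: real
    assume vw: "v \<in> {v \<in> S. h v \<noteq> \<infinity>}" "w \<in> {v \<in> S. h v \<noteq> \<infinity>}" "0 \<le> p" "0 \<le> q" "p + q = 1"
    then show "real_of_ereal (h (p *\<^sub>R v + q *\<^sub>R w)) \<le> p * real_of_ereal (h v) + q * real_of_ereal (h w)"
      using key[of v w p q] fin[of "p *\<^sub>R v + q *\<^sub>R w"] mem[OF vw] by (metis (mono_tags, lifting) ereal_less_eq(3) mem_Collect_eq)
  qed
qed

lemma nonneg_if_perturbation_nonneg:
  fixes a c :: real
  assumes "\<And>\<theta>. 0 < \<theta> \<Longrightarrow> \<theta> \<le> 1 \<Longrightarrow> 0 \<le> a + \<theta> * c"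
  shows "0 \<le> a"
proof (rule tendsto_lowerbound)
  show "((\<lambda>\<theta>. a + \<theta> * c) \<longlongrightarrow> a) (at_right 0)"
    by (auto intro!: tendsto_eq_intros)
  show "eventually (\<lambda>\<theta>. 0 \<le> a + \<theta> * c) (at_right 0)"
    unfolding eventually_at_right_field using assms by (intro exI[of _ 1]) auto
qed simp

text \<open>The minimiser is compared with points on the segment towards \<open>v\<close>: convexity
  bounds \<open>h\<close> there, the common factor \<theta> is divided out, and letting \<theta>
  tend to 0 removes the quadratic term. Finiteness at \<open>vs\<close> comes from comparison with
  any point where \<open>h\<close> is finite.\<close>

lemma prox_variational:
  fixes h :: "real ^ 'n::finite \<Rightarrow> ereal"
  assumes h: "proper_closed_convex_on S h" and M: "sym_mat M" and vs: "vs \<in> S"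
    and min: "\<And>v. v \<in> S \<Longrightarrow> ereal (c \<bullet> vs) + h vs + ereal (1 / 2 * qform M (vs - a))
        \<le> ereal (c \<bullet> v) + h v + ereal (1 / 2 * qform M (v - a))"
  shows "h vs \<noteq> \<infinity>"
    and "v \<in> S \<Longrightarrow> h v \<noteq> \<infinity> \<Longrightarrow>
      real_of_ereal (h vs) \<le> real_of_ereal (h v) + (c + M *v (vs - a)) \<bullet> (v - vs)"
proof -
  have fin: "ereal (real_of_ereal (h v)) = h v" if "v \<in> S" "h v \<noteq> \<infinity>" for v
    using h that by (auto simp: proper_closed_convex_on_def proper_on_def ereal_real)
  obtain v0 where v0: "v0 \<in> S" "h v0 \<noteq> \<infinity>"
    using h by (auto simp: proper_closed_convex_on_def proper_on_def)
  show vs_fin: "h vs \<noteq> \<infinity>"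
    using min[OF v0(1)] fin[OF v0, symmetric] by auto
  assume v: "v \<in> S" "h v \<noteq> \<infinity>"
  define w where "w = v - vs"
  have cv: "convex_on {v \<in> S. h v \<noteq> \<infinity>} (\<lambda>v. real_of_ereal (h v))"
    by (rule proper_closed_convex_on_imp_convex_on[OF h])
  have "0 \<le> (real_of_ereal (h v) - real_of_ereal (h vs) + (c + M *v (vs - a)) \<bullet> w) + \<theta> * (1 / 2 * qform M w)"
    if \<theta>: "0 < \<theta>" "\<theta> \<le> 1" for \<theta>
  proof -
    let ?v = "(1 - \<theta>) *\<^sub>R vs + \<theta> *\<^sub>R v"
    have v_eq: "?v = vs + \<theta> *\<^sub>R w" by (simp add: w_def algebra_simps)
    have mem: "?v \<in> {v \<in> S. h v \<noteq> \<infinity>}"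
      using convex_on_imp_convex[OF cv] vs vs_fin v \<theta> unfolding convex_def by simp
    have le: "real_of_ereal (h ?v) \<le> (1 - \<theta>) * real_of_ereal (h vs) + \<theta> * real_of_ereal (h v)"
      using convex_onD[OF cv, of \<theta> vs v] vs vs_fin v \<theta> by simp
    have "ereal (c \<bullet> vs) + ereal (real_of_ereal (h vs)) + ereal (1 / 2 * qform M (vs - a))
        \<le> ereal (c \<bullet> ?v) + ereal (real_of_ereal (h ?v)) + ereal (1 / 2 * qform M (?v - a))"
      using min[of ?v] fin[of vs] fin[of ?v] vs vs_fin mem by simp
    then have "c \<bullet> vs + real_of_ereal (h vs) + 1 / 2 * qform M (vs - a)
        \<le> c \<bullet> ?v + real_of_ereal (h ?v) + 1 / 2 * qform M (?v - a)"
      by simp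
    moreover have "qform M (?v - a) = qform M (vs - a) + 2 * \<theta> * ((M *v (vs - a)) \<bullet> w) + \<theta>\<^sup>2 * qform M w"
    proof -
      have "?v - a = (vs - a) + \<theta> *\<^sub>R w" by (simp add: v_eq)
      then show ?thesis
        using qform_add[OF M, of "vs - a" "\<theta> *\<^sub>R w"] sym_mat_inner[OF M, of "vs - a" w]
        by (simp only: qform_scaleR matrix_vector_mult_scaleR inner_scaleR_right mult.assoc)
    qed
    moreover have "c \<bullet> ?v = c \<bullet> vs + \<theta> * (c \<bullet> w)"
      by (simp add: v_eq inner_add_right)
    ultimately have "0 \<le> \<theta> * (real_of_ereal (h v) - real_of_ereal (h vs) + (c + M *v (vs - a)) \<bullet> w + \<theta> * (1 / 2 * qform M w))"
      using le by (simp add: algebra_simps power2_eq_square inner_add_left)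
    then show ?thesis using \<theta> by (simp add: zero_le_mult_iff)
  qed
  from nonneg_if_perturbation_nonneg[OF this]
  show "real_of_ereal (h vs) \<le> real_of_ereal (h v) + (c + M *v (vs - a)) \<bullet> (v - vs)"
    by (simp add: w_def)
qed


section \<open>Descent of the Lyapunov function\<close>

text \<open>With all entries of \<open>W\<close> equal to 1 the updates are of Jacobi type, with
  zeros below the diagonal and ones elsewhere of Gauss-Seidel type. A KKT point is a hypothesis of
  single lemmas because the estimates concern every such point.\<close>

locale hybrid_jacobi_gauss_seidel =
  fixes blk :: "'n::finite \<Rightarrow> 'm::finite"
    and Q :: "real ^ 'n ^ 'n"
    and H :: "real ^ 'n ^ 'p::finite"
    and A :: "real ^ 'n ^ 'q::finite"
    and b :: "real ^ 'q"
    and g :: "'m \<Rightarrow> real ^ 'n \<Rightarrow> ereal"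
    and P :: "'m \<Rightarrow> real ^ 'n ^ 'n"
    and W :: "real ^ 'm ^ 'm"
    and u :: "real ^ 'm"
    and \<alpha> \<beta> \<rho> :: real
    and x :: "nat \<Rightarrow> real ^ 'n"
    and lam :: "nat \<Rightarrow> real ^ 'q"
  assumes Q_psd: "psd Q"
    and Q_fact: "Q = transpose H ** H"
    and g_pcc: "\<And>i. proper_closed_convex_on (block_space blk i) (g i)"
    and P_psd: "\<And>i. psd (P i)"
    and U_sym: "sym_mat (U_mat W u)"
    and gen: "generated blk Q g A b \<beta> \<rho> W P x lam"
    and \<beta>\<rho>: "\<beta> \<ge> \<rho>" "\<rho> > 0"
    and \<alpha>: "\<alpha> \<ge> 1"
    and P_hat_psd: "psd (P_hat blk H A P W u \<alpha> \<beta>)"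
begin

abbreviation "B \<equiv> block blk"

text \<open>\<open>real_of_ereal\<close> sends infinite values to 0, so \<open>gr\<close> and
  \<open>Fr\<close> carry information only where the \<open>g i\<close> are finite, that is, on
  \<open>dom_F\<close>.\<close>

definition gr :: "'m \<Rightarrow> real ^ 'n \<Rightarrow> real" where
  "gr i v = real_of_ereal (g i v)"

definition dom_F :: "(real ^ 'n) set" where
  "dom_F = {v. \<forall>i. g i (B i v) \<noteq> \<infinity>}"

definition Fr :: "real ^ 'n \<Rightarrow> real" where
  "Fr v = f_obj Q v + (\<Sum>i\<in>UNIV. gr i (B i v))"

text \<open>This is \<open>(u\<^sup>T \<otimes> I) D\<^sub>M d\<close>, the contribution of
  \<open>e u\<^sup>T\<close> to the mixing; it is the same for every block row.\<close>

definition comb :: "real ^ 'n ^ 'r::finite \<Rightarrow> real ^ 'n \<Rightarrow> real ^ 'r" where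
  "comb M d = (\<Sum>j\<in>UNIV. u $ j *\<^sub>R (M *v B j d))"

text \<open>The bilinear form of \<open>V\<close> between \<open>D\<^sub>M a\<close> and
  \<open>D\<^sub>M c\<close>, expanded over blocks.\<close>

definition cross :: "real ^ 'n ^ 'r::finite \<Rightarrow> real ^ 'n \<Rightarrow> real ^ 'n \<Rightarrow> real" where
  "cross M a c = (\<Sum>i\<in>UNIV. \<Sum>j\<in>UNIV. U_mat W u $ i $ j * ((M *v B i a) \<bullet> (M *v B j c)))"

text \<open>The form \<open>S\<close> of the overview: \<open>P_hat\<close> without its \<alpha>
  term, from which it inherits positive semidefiniteness.\<close>

definition metric :: "real ^ 'n ^ 'n" where
  "metric = blkdiag blk P
     - transpose (blkdiag_cols blk H) ** kron (U_mat W u) (mat 1 :: real ^ 'p ^ 'p) ** blkdiag_cols blk H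
     - \<beta> *\<^sub>R (transpose (blkdiag_cols blk A) ** kron (U_mat W u) (mat 1 :: real ^ 'q ^ 'q) ** blkdiag_cols blk A)"

section \<open>Real-valued objective, KKT points and convexity\<close>

lemma g_not_MInfty: "v \<in> block_space blk i \<Longrightarrow> g i v \<noteq> - \<infinity>"
  using g_pcc[of i] by (auto simp: proper_closed_convex_on_def proper_on_def)

lemma ereal_gr: "v \<in> block_space blk i \<Longrightarrow> g i v \<noteq> \<infinity> \<Longrightarrow> g i v = ereal (gr i v)"
  using g_not_MInfty[of v i] by (cases "g i v") (auto simp: gr_def)

lemma F_obj_eq: "F_obj blk Q g v = (if v \<in> dom_F then ereal (Fr v) else \<infinity>)"
proof (cases "v \<in> dom_F")
  case True
  then have "g i (B i v) = ereal (gr i (B i v))" for i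
    by (intro ereal_gr block_in_block_space) (simp add: dom_F_def)
  then show ?thesis
    using True by (simp add: F_obj_def Fr_def)
next
  case False
  then have "(\<Sum>i\<in>UNIV. g i (B i v)) = \<infinity>"
    by (subst sum_Pinfty) (auto simp: dom_F_def)
  then show ?thesis
    using False by (simp add: F_obj_def)
qed

text \<open>The blocks are independent: points of finite value, one per block space, add up to a
  vector having exactly these blocks.\<close>

lemma dom_F_ne: "dom_F \<noteq> {}"
proof -
  have "\<forall>i. \<exists>v\<in>block_space blk i. g i v \<noteq> \<infinity>"
    using g_pcc by (auto simp: proper_closed_convex_on_def proper_on_def)
  then obtain w where w: "\<And>i. w i \<in> block_space blk i" "\<And>i. g i (w i) \<noteq> \<infinity>"
    by metis
  have "B i (\<Sum>j\<in>UNIV. w j) = w i" for i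
  proof -
    have "(\<Sum>j\<in>UNIV. w j) $ c = w (blk c) $ c" for c
    proof -
      have "(\<Sum>j\<in>UNIV. w j $ c) = (\<Sum>j\<in>UNIV. if j = blk c then w j $ c else 0)"
        by (intro sum.cong refl) (use w(1) in \<open>auto simp: block_space_def\<close>)
      then show ?thesis by simp
    qed
    then show ?thesis
      using w(1)[of i] by (auto simp: vec_eq_iff block_def block_space_def)
  qed
  then have "(\<Sum>j\<in>UNIV. w j) \<in> dom_F"
    using w(2) by (simp add: dom_F_def)
  then show ?thesis by blast
qed

text \<open>The subgradient inequality in real arithmetic. Since \<open>dom_F\<close> is nonempty,
  testing against one of its points forces the objective at \<open>xs\<close> to be finite.\<close>

lemma KKT_iff:
  "KKT blk Q g A b xs ls \<longleftrightarrow>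
     xs \<in> dom_F \<and> A *v xs = b \<and> (\<forall>y\<in>dom_F. Fr xs + ls \<bullet> (A *v y - A *v xs) \<le> Fr y)"
proof -
  have in_subdiff: "0 \<in> (\<lambda>v. v - transpose A *v ls) ` D \<longleftrightarrow> transpose A *v ls \<in> D" for D
    by (auto simp: image_iff)
  have "(transpose A *v ls) \<bullet> (y - xs) = ls \<bullet> (A *v y - A *v xs)" for y
    by (simp only: inner_transpose_mult matrix_vector_mult_diff_distrib)
  then have "KKT blk Q g A b xs ls \<longleftrightarrow> A *v xs = b \<and>
    (\<forall>y. F_obj blk Q g xs + ereal (ls \<bullet> (A *v y - A *v xs)) \<le> F_obj blk Q g y)"
    unfolding KKT_def in_subdiff by (auto simp: subdifferential_def)
  then show ?thesis
    using dom_F_ne by (auto simp: F_obj_eq)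
qed

lemma inner_Q: "(Q *v a) \<bullet> c = (H *v a) \<bullet> (H *v c)"
  unfolding Q_fact by (metis inner_transpose_mult matrix_vector_mul_assoc)

text \<open>The exact second-order Taylor expansion of a quadratic. The remainder is kept because it
  later pays for the pairing with \<open>comb H d\<close>.\<close>

lemma f_obj_expand:
  "f_obj Q a = f_obj Q c + (H *v c) \<bullet> (H *v (a - c)) + 1 / 2 * (norm (H *v (a - c)))\<^sup>2"
  using inner_Q[of a a] inner_Q[of c c]
  by (simp add: f_obj_def inner_commute[of _ "Q *v _"] power2_norm_eq_inner matrix_vector_mult_diff_distrib
        inner_diff_left inner_diff_right inner_commute[of "H *v a" "H *v c"] field_simps)

text \<open>Both values are bounded below by the tangent plane at the convex combination; the
  weighted linear terms cancel.\<close>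

lemma convex_on_f_obj: "convex_on UNIV (f_obj Q)"
  unfolding convex_on_def
proof (intro conjI ballI allI impI convex_UNIV)
  fix v w :: "real ^ 'n" and p q :: real
  assume pq: "0 \<le> p" "0 \<le> q" "p + q = 1"
  let ?z = "p *\<^sub>R v + q *\<^sub>R w"
  have "f_obj Q v \<ge> f_obj Q ?z + (H *v ?z) \<bullet> (H *v (v - ?z))"
    "f_obj Q w \<ge> f_obj Q ?z + (H *v ?z) \<bullet> (H *v (w - ?z))"
    using f_obj_expand[of v ?z] f_obj_expand[of w ?z] by auto
  then have "p * f_obj Q v + q * f_obj Q w \<ge>
     p * (f_obj Q ?z + (H *v ?z) \<bullet> (H *v (v - ?z))) + q * (f_obj Q ?z + (H *v ?z) \<bullet> (H *v (w - ?z)))"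
    using pq by (intro add_mono mult_left_mono) auto
  also have "p * (f_obj Q ?z + (H *v ?z) \<bullet> (H *v (v - ?z))) + q * (f_obj Q ?z + (H *v ?z) \<bullet> (H *v (w - ?z)))
     = (p + q) * f_obj Q ?z + (H *v ?z) \<bullet> (H *v (p *\<^sub>R (v - ?z) + q *\<^sub>R (w - ?z)))"
    by (simp add: matrix_vector_right_distrib matrix_vector_mult_scaleR inner_add_right algebra_simps)
  also have "p *\<^sub>R (v - ?z) + q *\<^sub>R (w - ?z) = ?z - (p + q) *\<^sub>R ?z"
    by (simp add: algebra_simps)
  finally show "f_obj Q ?z \<le> p * f_obj Q v + q * f_obj Q w"
    using pq by simp
qed

lemma convex_on_gr: "convex_on {v \<in> block_space blk i. g i v \<noteq> \<infinity>} (gr i)"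
  using proper_closed_convex_on_imp_convex_on[OF g_pcc[of i]] by (simp add: gr_def [abs_def])

text \<open>Convexity passes through the linear block projections and finite sums; it supplies
  Jensen's inequality for the averaged iterates.\<close>

lemma convex_on_Fr: "convex_on dom_F Fr"
proof -
  have blk_mem: "B i v \<in> {v \<in> block_space blk i. g i v \<noteq> \<infinity>}" if "v \<in> dom_F" for i v
    using that by (auto simp: dom_F_def block_in_block_space)
  have cdom: "convex dom_F"
    unfolding convex_def
  proof (intro ballI allI impI)
    fix v w and p q :: real
    assume *: "v \<in> dom_F" "w \<in> dom_F" "0 \<le> p" "0 \<le> q" "p + q = 1"
    then have "p *\<^sub>R B i v + q *\<^sub>R B i w \<in> {v \<in> block_space blk i. g i v \<noteq> \<infinity>}" for i
      using convex_on_imp_convex[OF convex_on_gr[of i]] blk_mem unfolding convex_def by blast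
    then show "p *\<^sub>R v + q *\<^sub>R w \<in> dom_F"
      by (simp add: dom_F_def block_add block_scaleR)
  qed
  have *: "convex_on dom_F (\<lambda>v. gr i (B i v))" for i
    unfolding convex_on_def
  proof (intro conjI cdom ballI allI impI)
    fix v w and p q :: real
    assume *: "v \<in> dom_F" "w \<in> dom_F" "0 \<le> p" "0 \<le> q" "p + q = 1"
    then show "gr i (B i (p *\<^sub>R v + q *\<^sub>R w)) \<le> p * gr i (B i v) + q * gr i (B i w)"
      using convex_on_gr[of i] blk_mem unfolding convex_on_def block_add block_scaleR by blast
  qed
  have "convex_on dom_F (\<lambda>v. \<Sum>i\<in>I. gr i (B i v))" if "finite I" for I
    using that by (induction I rule: finite_induct) (auto intro: convex_on_add * simp: convex_on_const cdom)
  moreover have "convex_on dom_F (f_obj Q)"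
    using convex_on_f_obj convex_on_subset cdom by blast
  ultimately show ?thesis
    unfolding Fr_def [abs_def] by (intro convex_on_add) auto
qed

section \<open>The quadratic form of the Lyapunov function\<close>

lemma inner_gram_mult:
  fixes M :: "real ^ 'n ^ 'r::finite"
  shows "a \<bullet> ((transpose M ** K ** M) *v c) = (M *v a) \<bullet> (K *v (M *v c))"
  using inner_transpose_mult[of M "K *v (M *v c)" a]
  by (simp add: inner_commute matrix_vector_mul_assoc[symmetric] del: transpose_matrix_vector)

lemma inner_metric:
  "a \<bullet> (metric *v c) = (\<Sum>i\<in>UNIV. B i a \<bullet> (P i *v B i c)) - cross H a c - \<beta> * cross A a c"
  by (simp add: metric_def matrix_vector_mult_diff_rdistrib inner_diff_right scaleR_matrix_vector_assoc[symmetric]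
      inner_gram_mult inner_kron_mat_1 inner_blkdiag cross_def)

text \<open>Here the symmetry of \<open>U\<close> enters: exchanging the two summations transposes
  the kernel.\<close>

lemma cross_commute: "cross M a c = cross M c a"
proof -
  have "U_mat W u $ i $ j = U_mat W u $ j $ i" for i j
    using arg_cong[OF U_sym[unfolded sym_mat_def], of "\<lambda>K. K $ j $ i"] by (simp add: transpose_def)
  then have "U_mat W u $ i $ j * ((M *v B i a) \<bullet> (M *v B j c))
    = U_mat W u $ j $ i * ((M *v B j c) \<bullet> (M *v B i a))" for i j
    by (simp only: inner_commute)
  then show ?thesis
    unfolding cross_def by (subst sum.swap) (simp only: )
qed

lemma sym_metric: "sym_mat metric"
proof -
  have "a \<bullet> (metric *v c) = c \<bullet> (metric *v a)" for a c
  proof -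
    have "B i a \<bullet> (P i *v B i c) = B i c \<bullet> (P i *v B i a)" for i
      using sym_mat_inner[of "P i" "B i a" "B i c"] P_psd[of i] by (simp add: psd_def inner_commute)
    then show ?thesis
      unfolding inner_metric using cross_commute[of H a c] cross_commute[of A a c] by simp
  qed
  then have "(transpose metric *v a) \<bullet> c = (metric *v a) \<bullet> c" for a c
    by (metis inner_transpose_mult inner_commute)
  then have "transpose metric *v a = metric *v a" for a
    using vector_eq_rdot by blast
  then show ?thesis
    unfolding sym_mat_def using matrix_eq by blast
qed

lemma norm_comb: "(norm (comb M d))\<^sup>2 = (\<Sum>i\<in>UNIV. \<Sum>j\<in>UNIV. u $ i * u $ j * ((M *v B i d) \<bullet> (M *v B j d)))"
  by (simp only: comb_def power2_norm_eq_inner inner_sum_left)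
    (simp add: inner_sum_right mult.assoc mult.left_commute)

text \<open>The extra kernel \<open>\<alpha> u u\<^sup>T\<close> in \<open>P_hat\<close> evaluates
  on the diagonal to \<alpha> times the squared norm of \<open>comb\<close>. These two squares are
  the reserve spent in \<open>descent\<close>.\<close>

lemma qform_metric:
  "qform metric d = qform (P_hat blk H A P W u \<alpha> \<beta>) d
     + \<alpha> * (norm (comb H d))\<^sup>2 + \<alpha> * \<beta> * (norm (comb A d))\<^sup>2"
proof -
  have K: "W - outer (vec 1) u + \<alpha> *\<^sub>R outer u u = U_mat W u + \<alpha> *\<^sub>R outer u u"
    by (simp add: U_mat_def)
  have "qform (P_hat blk H A P W u \<alpha> \<beta>) d =
     (\<Sum>i\<in>UNIV. B i d \<bullet> (P i *v B i d)) - (cross H d d + \<alpha> * (norm (comb H d))\<^sup>2)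
     - \<beta> * (cross A d d + \<alpha> * (norm (comb A d))\<^sup>2)"
    unfolding qform_def P_hat_def K cross_def norm_comb
    by (simp add: matrix_vector_mult_diff_rdistrib inner_diff_right scaleR_matrix_vector_assoc[symmetric]
      inner_gram_mult inner_kron_mat_1 inner_blkdiag outer_def distrib_right sum.distrib sum_distrib_left mult.assoc)
  then show ?thesis
    unfolding qform_def inner_metric by (simp add: algebra_simps)
qed

lemma qform_metric_ge: "qform (P_hat blk H A P W u \<alpha> \<beta>) d \<le> qform metric d"
  unfolding qform_metric using \<alpha> \<beta>\<rho> by simp

lemma qform_metric_nonneg: "0 \<le> qform metric d"
  using qform_metric_ge[of d] P_hat_psd unfolding psd_def by (meson order_trans)

section \<open>Optimality of the block updates\<close>

lemma lam_1: "lam 1 = 0"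
  and lam_Suc: "k \<ge> 1 \<Longrightarrow> lam (Suc k) = lam k - \<rho> *\<^sub>R (A *v x (Suc k) - b)"
  using gen by (auto simp: generated_def)

text \<open>The gradient of the smooth part of the subproblem at its solution;
  \<open>- direction k i\<close> is a subgradient of \<open>g i\<close> at the new block, relative
  to the block space.\<close>

definition direction :: "nat \<Rightarrow> 'm \<Rightarrow> real ^ 'n" where
  "direction k i = (let xh = xhat blk W i (x k) (x (Suc k)) in
     B i (Q *v xh) - B i (transpose A *v (lam k - \<beta> *\<^sub>R (A *v xh - b)))
     + P i *v B i (x (Suc k) - x k))"

lemma block_optimality:
  assumes k: "k \<ge> 1"
  shows "g i (B i (x (Suc k))) \<noteq> \<infinity>"
    and "v \<in> block_space blk i \<Longrightarrow> g i v \<noteq> \<infinity> \<Longrightarrow>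
       gr i (B i (x (Suc k))) \<le> gr i v + direction k i \<bullet> (v - B i (x (Suc k)))"
proof -
  let ?xh = "xhat blk W i (x k) (x (Suc k))"
  let ?c = "partial_grad blk i (f_obj Q) ?xh - transpose (col_block blk i A) *v (lam k - \<beta> *\<^sub>R (A *v ?xh - b))"
  have min: "ereal (?c \<bullet> B i (x (Suc k))) + g i (B i (x (Suc k)))
      + ereal (1 / 2 * qform (P i) (B i (x (Suc k)) - B i (x k)))
     \<le> ereal (?c \<bullet> v) + g i v + ereal (1 / 2 * qform (P i) (v - B i (x k)))"
    if "v \<in> block_space blk i" for v
    using gen k that
    unfolding generated_def subproblem_sols_def is_arg_min_def subproblem_obj_def
    by (simp only: mem_Collect_eq not_less) (meson leI)
  have symP: "sym_mat (P i)" and symQ: "sym_mat Q" using P_psd Q_psd by (auto simp: psd_def)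
  have c: "?c + P i *v (B i (x (Suc k)) - B i (x k)) = direction k i"
    by (simp only: partial_grad_def grad_f_obj[OF symQ] transpose_col_block_mult direction_def Let_def block_diff)
  note pv = prox_variational[OF g_pcc symP block_in_block_space min]
  show "g i (B i (x (Suc k))) \<noteq> \<infinity>" using pv(1) by blast
  show "gr i (B i (x (Suc k))) \<le> gr i v + direction k i \<bullet> (v - B i (x (Suc k)))"
    if "v \<in> block_space blk i" "g i v \<noteq> \<infinity>"
    using pv(2)[OF _ that] unfolding gr_def c by blast
qed

lemma x_in_dom_F: "k \<ge> 1 \<Longrightarrow> x (Suc k) \<in> dom_F"
  using block_optimality(1) by (simp add: dom_F_def)

text \<open>Split \<open>W $ i $ j\<close> into its \<open>U\<close> entry and \<open>u $ j\<close>.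
  The second part does not depend on \<open>i\<close>, so it factors out as \<open>comb\<close>
  against all of \<open>M *v w\<close>; the first part is \<open>cross\<close>.\<close>

lemma sum_inner_xhat:
  fixes M :: "real ^ 'n ^ 'r::finite"
  shows "(\<Sum>i\<in>UNIV. (M *v xhat blk W i x0 x1 - c) \<bullet> (M *v B i w))
    = (M *v x1 - c - comb M (x1 - x0)) \<bullet> (M *v w) - cross M (x1 - x0) w"
proof -
  let ?d = "x1 - x0"
  have Wij: "W $ i $ j = U_mat W u $ i $ j + u $ j" for i j
    by (simp add: U_mat_def outer_def)
  have "(\<Sum>j\<in>UNIV. W $ i $ j *\<^sub>R (M *v B j ?d)) = (\<Sum>j\<in>UNIV. U_mat W u $ i $ j *\<^sub>R (M *v B j ?d)) + comb M ?d" for i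
    by (simp add: Wij comb_def scaleR_left_distrib sum.distrib)
  then have "(\<Sum>i\<in>UNIV. (M *v xhat blk W i x0 x1 - c) \<bullet> (M *v B i w))
    = (\<Sum>i\<in>UNIV. (M *v x1 - c - comb M ?d) \<bullet> (M *v B i w)
        - (\<Sum>j\<in>UNIV. U_mat W u $ i $ j *\<^sub>R (M *v B j ?d)) \<bullet> (M *v B i w))"
    by (intro sum.cong refl) (simp add: mult_xhat inner_diff_left inner_add_left)
  also have "\<dots> = (M *v x1 - c - comb M ?d) \<bullet> (\<Sum>i\<in>UNIV. M *v B i w) - cross M w ?d"
    by (simp add: sum_subtractf inner_sum_right cross_def inner_sum_left inner_commute)
  finally show ?thesis
    using mult_eq_sum_block[of M w blk] cross_commute[of M w ?d] by simp
qed

text \<open>Both the \<open>H\<close> and the \<open>A\<close> part fall under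
  \<open>sum_inner_xhat\<close>; their \<open>cross\<close> terms join the proximal terms to form
  \<open>metric\<close>.\<close>

lemma sum_direction:
  "(\<Sum>i\<in>UNIV. direction k i \<bullet> B i w) =
     (H *v x (Suc k) - comb H (x (Suc k) - x k)) \<bullet> (H *v w)
     + (\<beta> *\<^sub>R (A *v x (Suc k) - b - comb A (x (Suc k) - x k)) - lam k) \<bullet> (A *v w)
     + (x (Suc k) - x k) \<bullet> (metric *v w)"
proof -
  let ?d = "x (Suc k) - x k"
  let ?xh = "\<lambda>i. xhat blk W i (x k) (x (Suc k))"
  \<comment> \<open>The \<open>- 0\<close> makes the term an instance of
    \<open>sum_inner_xhat\<close> with \<open>c = 0\<close>; the \<open>A\<close> term uses
    \<open>c = b\<close>.\<close>
  have "direction k i \<bullet> B i w = (H *v ?xh i - 0) \<bullet> (H *v B i w)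
      + \<beta> * ((A *v ?xh i - b) \<bullet> (A *v B i w)) - lam k \<bullet> (A *v B i w) + B i ?d \<bullet> (P i *v B i w)" for i
  proof -
    have "(transpose A *v y) \<bullet> B i w = y \<bullet> (A *v B i w)" for y
      by (rule inner_transpose_mult)
    then show ?thesis
      using sym_mat_inner[of "P i" "B i ?d" "B i w"] P_psd[of i]
      by (simp add: direction_def Let_def inner_add_left inner_diff_left inner_block block_block inner_Q psd_def
           del: transpose_matrix_vector)
  qed
  then have "(\<Sum>i\<in>UNIV. direction k i \<bullet> B i w) =
      (\<Sum>i\<in>UNIV. (H *v ?xh i - 0) \<bullet> (H *v B i w)) + \<beta> * (\<Sum>i\<in>UNIV. (A *v ?xh i - b) \<bullet> (A *v B i w))
      - lam k \<bullet> (\<Sum>i\<in>UNIV. A *v B i w) + (\<Sum>i\<in>UNIV. B i ?d \<bullet> (P i *v B i w))"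
    by (simp only: sum.distrib sum_subtractf sum_distrib_left inner_sum_right)
  then show ?thesis
    unfolding sum_inner_xhat mult_eq_sum_block[of A w blk, symmetric] inner_metric
    by (simp add: inner_diff_left algebra_simps)
qed

text \<open>Summed block inequalities plus the expansion of \<open>f\<close> at the new iterate; the
  linear term of \<open>f\<close> cancels against the gradient inside
  \<open>sum_direction\<close>.\<close>

lemma iteration_inequality:
  assumes k: "k \<ge> 1" and v: "v \<in> dom_F"
  defines "d \<equiv> x (Suc k) - x k" and "w \<equiv> v - x (Suc k)"
  shows "Fr (x (Suc k)) + 1 / 2 * (norm (H *v w))\<^sup>2 \<le> Fr v
     - comb H d \<bullet> (H *v w)
     + (\<beta> *\<^sub>R (A *v x (Suc k) - b - comb A d) - lam k) \<bullet> (A *v w)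
     + d \<bullet> (metric *v w)"
proof -
  have "gr i (B i (x (Suc k))) \<le> gr i (B i v) + direction k i \<bullet> B i w" for i
    using block_optimality(2)[OF k block_in_block_space, of i v] v
    by (simp add: dom_F_def w_def block_diff)
  then have "(\<Sum>i\<in>UNIV. gr i (B i (x (Suc k)))) \<le> (\<Sum>i\<in>UNIV. gr i (B i v)) + (\<Sum>i\<in>UNIV. direction k i \<bullet> B i w)"
    by (simp add: sum_mono flip: sum.distrib)
  then show ?thesis
    using f_obj_expand[of v "x (Suc k)"]
    unfolding sum_direction Fr_def w_def[symmetric] d_def[symmetric]
    by (simp add: inner_diff_left)
qed

text \<open>The centre \<open>\<mu>\<close> is left free, since the rate needs a multiplier chosen
  from the averaged residual and convergence needs a KKT multiplier.\<close>

definition lyap :: "real ^ 'n \<Rightarrow> real ^ 'q \<Rightarrow> nat \<Rightarrow> real" where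
  "lyap v \<mu> k = (norm (lam k - \<mu>))\<^sup>2 / \<rho> + qform metric (x k - v)"

lemma lyap_nonneg: "0 \<le> lyap v \<mu> k"
  unfolding lyap_def using qform_metric_nonneg \<beta>\<rho> by simp

lemma descent:
  assumes k: "k \<ge> 1" and v: "v \<in> dom_F" "A *v v = b"
  defines "d \<equiv> x (Suc k) - x k" and "r \<equiv> A *v x (Suc k) - b"
  shows "2 * (Fr (x (Suc k)) - Fr v - \<mu> \<bullet> r) + lyap v \<mu> (Suc k)
      + qform (P_hat blk H A P W u \<alpha> \<beta>) d + \<beta> * (norm (r - comb A d))\<^sup>2 \<le> lyap v \<mu> k"
proof -
  define e where "e = x (Suc k) - v"
  define h where "h = H *v e"
  have w: "v - x (Suc k) = - e" by (simp add: e_def)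
  have Ae: "A *v e = r" by (simp add: e_def r_def matrix_vector_mult_diff_distrib v(2))
  have neg: "M *v (- e) = - (M *v e)" for M :: "real ^ 'n ^ 'r::finite"
    by (metis matrix_vector_mult_diff_distrib diff_0 matrix_vector_mult_0_right)
  have main: "Fr (x (Suc k)) + 1 / 2 * (norm h)\<^sup>2 \<le> Fr v + comb H d \<bullet> h
     - (\<beta> *\<^sub>R (r - comb A d) - lam k) \<bullet> r - d \<bullet> (metric *v e)"
    using iteration_inequality[OF k v(1)]
    unfolding w neg Ae h_def[symmetric] d_def[symmetric] r_def[symmetric] by simp
  \<comment> \<open>Polarisation along \<open>x k - v = e - d\<close> turns the mixed term of
    \<open>main\<close> into a difference of consecutive Lyapunov terms.\<close>
  have q: "qform metric (x k - v) = qform metric e - 2 * (d \<bullet> (metric *v e)) + qform metric d"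
  proof -
    have "x k - v = e + (-1) *\<^sub>R d" by (simp add: e_def d_def)
    then show ?thesis
      using qform_add[OF sym_metric, of e "(-1) *\<^sub>R d"] sym_mat_inner[OF sym_metric, of d e]
      by (simp only: qform_scaleR matrix_vector_mult_scaleR inner_scaleR_right inner_commute[of "metric *v d"]) simp
  qed
  have l: "(norm (lam (Suc k) - \<mu>))\<^sup>2 / \<rho> = (norm (lam k - \<mu>))\<^sup>2 / \<rho> - 2 * ((lam k - \<mu>) \<bullet> r) + \<rho> * (norm r)\<^sup>2"
  proof -
    have "lam (Suc k) - \<mu> = (lam k - \<mu>) - \<rho> *\<^sub>R r" by (simp add: lam_Suc[OF k] r_def)
    then have "(norm (lam (Suc k) - \<mu>))\<^sup>2 = (norm (lam k - \<mu>))\<^sup>2 - 2 * \<rho> * ((lam k - \<mu>) \<bullet> r) + \<rho>\<^sup>2 * (norm r)\<^sup>2"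
      by (simp only: power2_norm_eq_inner)
        (simp add: inner_diff_left inner_diff_right inner_commute power2_eq_square algebra_simps)
    then show ?thesis using \<beta>\<rho> by (simp add: field_simps power2_eq_square)
  qed
  have sq: "(norm (a - c))\<^sup>2 = (norm a)\<^sup>2 - 2 * (c \<bullet> a) + (norm c)\<^sup>2" for a c :: "real ^ 'r::finite"
    by (simp add: power2_norm_eq_inner inner_diff_left inner_diff_right inner_commute)
  \<comment> \<open>The square of \<open>h - comb H d\<close>, completed with the Taylor remainder
    of \<open>f\<close>; \<open>\<alpha> \<ge> 1\<close> supplies its last term.\<close>
  have H_sq: "0 \<le> (norm h)\<^sup>2 - 2 * (comb H d \<bullet> h) + \<alpha> * (norm (comb H d))\<^sup>2"
  proof -
    have "(norm (comb H d))\<^sup>2 \<le> \<alpha> * (norm (comb H d))\<^sup>2"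
      using \<alpha> mult_right_mono[of 1 \<alpha> "(norm (comb H d))\<^sup>2"] by simp
    then show ?thesis using sq[of h "comb H d"] zero_le_power2[of "norm (h - comb H d)"] by linarith
  qed
  \<comment> \<open>The multiplier update costs \<open>\<rho>\<close> times the squared residual out
    of the available \<open>2 * \<beta>\<close>. As \<open>\<beta> \<ge> \<rho>\<close>, enough
    remains for a full square, kept in the conclusion to control the residual.\<close>
  have A_sq: "\<beta> * (norm (r - comb A d))\<^sup>2 \<le>
     (2 * \<beta> - \<rho>) * (norm r)\<^sup>2 - 2 * \<beta> * (comb A d \<bullet> r) + \<alpha> * \<beta> * (norm (comb A d))\<^sup>2"
  proof -
    have "1 * \<beta> * (norm (comb A d))\<^sup>2 \<le> \<alpha> * \<beta> * (norm (comb A d))\<^sup>2"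
      using \<alpha> \<beta>\<rho> by (intro mult_right_mono) auto
    moreover have "\<beta> * (norm r)\<^sup>2 \<le> (2 * \<beta> - \<rho>) * (norm r)\<^sup>2"
      using \<beta>\<rho> by (intro mult_right_mono) auto
    ultimately show ?thesis unfolding sq by (simp add: algebra_simps)
  qed
  have "(\<beta> *\<^sub>R (r - comb A d) - lam k) \<bullet> r = \<beta> * (norm r)\<^sup>2 - \<beta> * (comb A d \<bullet> r) - lam k \<bullet> r"
    by (simp add: inner_diff_left power2_norm_eq_inner algebra_simps)
  then show ?thesis
    using main q l H_sq A_sq qform_metric[of d]
    unfolding lyap_def e_def[symmetric] by (simp add: inner_diff_left dot_square_norm algebra_simps)
qed

lemma KKT_gap:
  assumes "KKT blk Q g A b xs ls" and "v \<in> dom_F"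
  shows "0 \<le> Fr v - Fr xs - ls \<bullet> (A *v v - b)"
  using assms unfolding KKT_iff by force


section \<open>Ergodic rate\<close>

lemma descent_sum:
  assumes v: "v \<in> dom_F" "A *v v = b"
  shows "(\<Sum>k=1..t. 2 * (Fr (x (Suc k)) - Fr v - \<mu> \<bullet> (A *v x (Suc k) - b))
      + qform (P_hat blk H A P W u \<alpha> \<beta>) (x (Suc k) - x k)
      + \<beta> * (norm (A *v x (Suc k) - b - comb A (x (Suc k) - x k)))\<^sup>2) + lyap v \<mu> (Suc t) \<le> lyap v \<mu> 1"
proof (induction t)
  case (Suc t)
  then show ?case
    using descent[of "Suc t" v \<mu>] v by simp
qed simp

text \<open>Dividing the telescoped descent by \<open>t\<close>: Jensen handles the objective, the
  residual is affine, and the nonnegative squares are dropped.\<close>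

lemma ergodic_bound:
  assumes v: "v \<in> dom_F" "A *v v = b" and t: "t \<ge> 1"
  defines "xbar \<equiv> (1 / real t) *\<^sub>R (\<Sum>k=1..t. x (Suc k))"
  shows "xbar \<in> dom_F" and "2 * real t * (Fr xbar - Fr v - \<mu> \<bullet> (A *v xbar - b)) \<le> lyap v \<mu> 1"
proof -
  have xbar: "xbar = (\<Sum>k=1..t. (1 / real t) *\<^sub>R x (Suc k))"
    by (simp add: xbar_def scaleR_sum_right)
  \<comment> \<open>The average starts at \<open>x 2\<close>: only outputs of subproblems are known
    to lie in \<open>dom_F\<close>, while \<open>x 1\<close> is arbitrary.\<close>
  have mem: "x (Suc k) \<in> dom_F" if "k \<in> {1..t}" for k
    using x_in_dom_F that by simp
  show "xbar \<in> dom_F"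
    unfolding xbar using convex_on_imp_convex[OF convex_on_Fr] mem t
    by (intro convex_sum) auto
  have "Fr xbar \<le> (\<Sum>k=1..t. 1 / real t * Fr (x (Suc k)))"
    unfolding xbar using mem t by (intro convex_on_sum[OF _ _ convex_on_Fr]) auto
  then have jensen: "t * Fr xbar \<le> (\<Sum>k=1..t. Fr (x (Suc k)))"
    using t by (simp add: field_simps flip: sum_divide_distrib)
  have resid: "real t *\<^sub>R (A *v xbar - b) = (\<Sum>k=1..t. A *v x (Suc k) - b)"
    using t by (simp add: xbar_def matrix_vector_mult_scaleR linear_sum[OF matrix_vector_mul_linear]
        sum_subtractf scaleR_diff_right sum_constant_scaleR del: sum_constant)
  have "(\<Sum>k=1..t. 2 * (Fr (x (Suc k)) - Fr v - \<mu> \<bullet> (A *v x (Suc k) - b)))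
    \<le> (\<Sum>k=1..t. 2 * (Fr (x (Suc k)) - Fr v - \<mu> \<bullet> (A *v x (Suc k) - b))
      + qform (P_hat blk H A P W u \<alpha> \<beta>) (x (Suc k) - x k)
      + \<beta> * (norm (A *v x (Suc k) - b - comb A (x (Suc k) - x k)))\<^sup>2)"
    using P_hat_psd \<beta>\<rho> by (intro sum_mono) (simp add: psd_def add_nonneg_nonneg)
  also have "\<dots> \<le> lyap v \<mu> 1"
    using descent_sum[OF v, where t = t and \<mu> = \<mu>] lyap_nonneg[of v \<mu> "Suc t"] by linarith
  also have "(\<Sum>k=1..t. 2 * (Fr (x (Suc k)) - Fr v - \<mu> \<bullet> (A *v x (Suc k) - b)))
     = 2 * ((\<Sum>k=1..t. Fr (x (Suc k))) - t * Fr v - \<mu> \<bullet> (real t *\<^sub>R (A *v xbar - b)))"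
    unfolding resid inner_sum_right by (simp add: sum_subtractf flip: sum_distrib_left)
  finally show "2 * real t * (Fr xbar - Fr v - \<mu> \<bullet> (A *v xbar - b)) \<le> lyap v \<mu> 1"
    using jensen by (simp add: algebra_simps)
qed

text \<open>Its three quadratic terms are the expansion of \<open>metric\<close>, so the bracket
  bounds \<open>lyap\<close> at index 1.\<close>

lemma rate_const_eq:
  "rate_const blk H A P W u \<beta> \<rho> x1 xs ls =
     max ((1 + norm ls)\<^sup>2) (4 * (norm ls)\<^sup>2) / \<rho> + qform metric (x1 - xs)"
proof -
  have "qform metric d = qform (blkdiag blk P) d
     - qform (kron (U_mat W u) (mat 1 :: real ^ 'p ^ 'p)) (blkdiag_cols blk H *v d)
     - \<beta> * qform (kron (U_mat W u) (mat 1 :: real ^ 'q ^ 'q)) (blkdiag_cols blk A *v d)" for d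
    unfolding qform_def inner_metric inner_kron_mat_1 inner_blkdiag cross_def ..
  then show ?thesis
    unfolding rate_const_def by (simp add: matrix_vector_mult_diff_distrib)
qed

lemma rate:
  assumes kkt: "KKT blk Q g A b xs ls" and t: "t \<ge> 1"
  defines "xbar \<equiv> (1 / real t) *\<^sub>R (\<Sum>k=1..t. x (Suc k))"
    and "C \<equiv> rate_const blk H A P W u \<beta> \<rho> (x 1) xs ls"
  shows "\<bar>F_obj blk Q g xbar - F_obj blk Q g xs\<bar> \<le> ereal (1 / (2 * real t) * C)"
    and "norm (A *v xbar - b) \<le> 1 / (2 * real t) * C"
proof -
  have xs: "xs \<in> dom_F" "A *v xs = b" using kkt by (simp_all add: KKT_iff)
  have mem: "xbar \<in> dom_F" unfolding xbar_def by (rule ergodic_bound(1)[OF xs t])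
  define r where "r = A *v xbar - b"
  \<comment> \<open>The first entry leaves one spare residual norm after the KKT lower bound, which
    gives feasibility; the second makes that lower bound itself at least \<open>- K\<close>.\<close>
  define c where "c = max (1 + norm ls) (2 * norm ls)"
  define K where "K = 1 / (2 * real t) * C"
  define D where "D = Fr xbar - Fr xs"
  have c: "1 + norm ls \<le> c" "2 * norm ls \<le> c" "0 \<le> c" by (auto simp: c_def max_def)
  have c2: "c\<^sup>2 = max ((1 + norm ls)\<^sup>2) (4 * (norm ls)\<^sup>2)"
  proof -
    have eq: "4 * (norm ls)\<^sup>2 = (2 * norm ls)\<^sup>2" by (simp add: power2_eq_square)
    have iff: "(1 + norm ls)\<^sup>2 \<le> (2 * norm ls)\<^sup>2 \<longleftrightarrow> 1 + norm ls \<le> 2 * norm ls"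
      by (rule power_mono_iff) auto
    show ?thesis
      unfolding eq c_def max_def iff by (simp only: if_distrib[of "\<lambda>a. a\<^sup>2"])
  qed
  \<comment> \<open>Length \<open>c\<close>, opposite to the residual; for \<open>r = 0\<close> it
    is 0 and both facts below still hold.\<close>
  define \<mu> where "\<mu> = - ((c / norm r) *\<^sub>R r)"
  have mu_r: "\<mu> \<bullet> r = - c * norm r"
    by (cases "r = 0") (auto simp: \<mu>_def dot_square_norm power2_eq_square)
  have "norm \<mu> \<le> c"
    using c(3) by (cases "r = 0") (auto simp: \<mu>_def)
  then have "(norm \<mu>)\<^sup>2 \<le> c\<^sup>2" by (intro power_mono norm_ge_zero)
  \<comment> \<open>As \<open>lam 1 = 0\<close>, the multiplier part of the initial value is just
    the squared norm of \<open>\<mu>\<close> over \<open>\<rho>\<close>.\<close>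
  then have "lyap xs \<mu> 1 \<le> C"
    unfolding lyap_def lam_1 C_def rate_const_eq c2[symmetric]
    using \<beta>\<rho> by (auto simp: divide_right_mono)
  then have "2 * real t * (D + c * norm r) \<le> C"
    using ergodic_bound(2)[OF xs t, of \<mu>] mu_r
    unfolding xbar_def[symmetric] r_def[symmetric] D_def by simp
  then have up: "D + c * norm r \<le> K"
    using t by (simp add: K_def field_simps)
  have "ls \<bullet> r \<ge> - (norm ls * norm r)"
    using Cauchy_Schwarz_ineq2[of ls r] by linarith
  then have low: "- (norm ls * norm r) \<le> D"
    using KKT_gap[OF kkt mem] unfolding r_def[symmetric] D_def by linarith
  have c_r: "(1 + norm ls) * norm r \<le> c * norm r" "2 * norm ls * norm r \<le> c * norm r"
    using c by (auto intro!: mult_right_mono)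
  show "norm (A *v xbar - b) \<le> 1 / (2 * real t) * C"
    using up low c_r(1) unfolding r_def[symmetric] K_def[symmetric] by (simp add: algebra_simps)
  have "0 \<le> c * norm r" using c by simp
  then have "\<bar>D\<bar> \<le> K"
    using up low c_r(2) by (simp add: abs_le_iff)
  then show "\<bar>F_obj blk Q g xbar - F_obj blk Q g xs\<bar> \<le> ereal (1 / (2 * real t) * C)"
    using mem xs unfolding K_def[symmetric] by (simp add: F_obj_eq D_def)
qed

section \<open>Convergence\<close>

text \<open>The constant is the uniform modulus that \<open>pd_lower_bound\<close> extracts from a
  positive definite \<open>P_hat\<close>.\<close>

context
  fixes c :: real
  assumes c_pos: "c > 0"
    and P_hat_ge: "\<And>v. c * (norm v)\<^sup>2 \<le> qform (P_hat blk H A P W u \<alpha> \<beta>) v"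
begin

lemma lyap_ge: "(norm (lam k - \<mu>))\<^sup>2 / \<rho> + c * (norm (x k - v))\<^sup>2 \<le> lyap v \<mu> k"
  unfolding lyap_def using P_hat_ge[of "x k - v"] qform_metric_ge[of "x k - v"] by linarith

text \<open>With a KKT multiplier as centre the Lagrangian gap is nonnegative, so the decrease
  controls both the increment and the shifted residual.\<close>

lemma lyap_step:
  assumes kkt: "KKT blk Q g A b xs ls" and k: "k \<ge> 1"
  defines "d \<equiv> x (Suc k) - x k"
  shows "c * (norm d)\<^sup>2 + \<beta> * (norm (A *v x (Suc k) - b - comb A d))\<^sup>2
     \<le> lyap xs ls k - lyap xs ls (Suc k)"
proof -
  have xs: "xs \<in> dom_F" "A *v xs = b" using kkt by (simp_all add: KKT_iff)
  show ?thesis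
    using descent[OF k xs, of ls] KKT_gap[OF kkt x_in_dom_F[OF k]] P_hat_ge[of d]
    unfolding d_def by simp
qed

lemma lyap_decreasing:
  assumes kkt: "KKT blk Q g A b xs ls"
  shows "antimono (\<lambda>k. lyap xs ls (Suc k))"
proof (rule decseq_SucI)
  fix k
  let ?d = "x (Suc (Suc k)) - x (Suc k)"
  have "0 \<le> c * (norm ?d)\<^sup>2 + \<beta> * (norm (A *v x (Suc (Suc k)) - b - comb A ?d))\<^sup>2"
    using c_pos \<beta>\<rho> by simp
  also have "\<dots> \<le> lyap xs ls (Suc k) - lyap xs ls (Suc (Suc k))"
    by (rule lyap_step[OF kkt]) simp
  finally show "lyap xs ls (Suc (Suc k)) \<le> lyap xs ls (Suc k)" by simp
qed

text \<open>A decreasing nonnegative sequence converges, so its successive differences vanish and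
  squeeze the squares. The residual follows because \<open>comb A\<close> of the increments also
  vanishes.\<close>

lemma increments_tendsto_0:
  assumes kkt: "KKT blk Q g A b xs ls"
  shows "(\<lambda>k. x (Suc (Suc k)) - x (Suc k)) \<longlonglongrightarrow> 0"
    and "(\<lambda>k. A *v x (Suc (Suc k)) - b) \<longlonglongrightarrow> 0"
proof -
  let ?d = "\<lambda>k. x (Suc (Suc k)) - x (Suc k)"
  let ?r = "\<lambda>k. A *v x (Suc (Suc k)) - b"
  let ?l = "\<lambda>k. lyap xs ls (Suc k)"
  have step: "c * (norm (?d k))\<^sup>2 + \<beta> * (norm (?r k - comb A (?d k)))\<^sup>2 \<le> ?l k - ?l (Suc k)" for k
    by (rule lyap_step[OF kkt]) simp
  obtain L where "?l \<longlonglongrightarrow> L"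
    using decseq_convergent[OF lyap_decreasing[OF kkt], of 0] lyap_nonneg by metis
  then have diff0: "(\<lambda>k. ?l k - ?l (Suc k)) \<longlonglongrightarrow> 0"
    using tendsto_diff[OF _ LIMSEQ_Suc, of ?l L ?l L] by simp
  have sq0: "f \<longlonglongrightarrow> 0" if "a > 0" "\<And>k. a * (norm (f k))\<^sup>2 \<le> ?l k - ?l (Suc k)"
    for f :: "nat \<Rightarrow> real ^ 's::finite" and a
  proof -
    have "(\<lambda>k. a * (norm (f k))\<^sup>2) \<longlonglongrightarrow> 0"
      by (rule tendsto_sandwich[OF _ _ tendsto_const diff0]) (use that in auto)
    then have "(\<lambda>k. (norm (f k))\<^sup>2) \<longlonglongrightarrow> 0"
      using that(1) tendsto_mult_left_iff[of a "\<lambda>k. (norm (f k))\<^sup>2" 0] by simp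
    then show ?thesis
      using tendsto_real_sqrt[of "\<lambda>k. (norm (f k))\<^sup>2" 0] tendsto_norm_zero_iff[of f] by simp
  qed
  show d0: "?d \<longlonglongrightarrow> 0"
  proof (rule sq0[OF c_pos])
    fix k
    have "0 \<le> \<beta> * (norm (?r k - comb A (?d k)))\<^sup>2" using \<beta>\<rho> by simp
    then show "c * (norm (?d k))\<^sup>2 \<le> ?l k - ?l (Suc k)" using step[of k] by linarith
  qed
  have "(\<lambda>k. ?r k - comb A (?d k)) \<longlonglongrightarrow> 0"
  proof (rule sq0[of \<beta>])
    fix k
    have "0 \<le> c * (norm (?d k))\<^sup>2" using c_pos by simp
    then show "\<beta> * (norm (?r k - comb A (?d k)))\<^sup>2 \<le> ?l k - ?l (Suc k)" using step[of k] by linarith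
  qed (use \<beta>\<rho> in simp)
  moreover have "(\<lambda>k. comb A (?d k)) \<longlonglongrightarrow> comb A 0"
    unfolding comb_def by (intro tendsto_intros d0)
  moreover have "comb A 0 = 0"
    by (simp add: comb_def linear_0[OF linear_block])
  ultimately show "?r \<longlonglongrightarrow> 0"
    using tendsto_add[of "\<lambda>k. ?r k - comb A (?d k)" 0 sequentially "\<lambda>k. comb A (?d k)" 0] by simp
qed

text \<open>Vanishing increments and residuals make the proximal, mixing and penalty terms disappear
  from \<open>direction\<close>. The block inequalities in the limit then sum to the subgradient
  inequality for \<open>F\<close>.\<close>

lemma cluster_point_KKT:
  assumes kkt: "KKT blk Q g A b xs ls" and \<sigma>: "strict_mono \<sigma>"
    and x_lim: "(\<lambda>k. x (Suc (\<sigma> k))) \<longlonglongrightarrow> xinf" and lam_lim: "(\<lambda>k. lam (Suc (\<sigma> k))) \<longlonglongrightarrow> linf"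
  shows "KKT blk Q g A b xinf linf"
proof -
  note d0 = LIMSEQ_subseq_LIMSEQ[OF increments_tendsto_0(1)[OF kkt] \<sigma>, unfolded o_def]
  note r0 = LIMSEQ_subseq_LIMSEQ[OF increments_tendsto_0(2)[OF kkt] \<sigma>, unfolded o_def]
  have x_lim': "(\<lambda>k. x (Suc (Suc (\<sigma> k)))) \<longlonglongrightarrow> xinf"
    using tendsto_add[OF x_lim d0] by simp
  have feas: "A *v xinf = b"
    using LIMSEQ_unique[OF r0 tendsto_diff[OF tendsto_mult_vec[OF x_lim'] tendsto_const]] by simp
  have xhat_lim: "(\<lambda>k. xhat blk W i (x (Suc (\<sigma> k))) (x (Suc (Suc (\<sigma> k))))) \<longlonglongrightarrow> xinf" for i
  proof -
    have "(\<lambda>k. xhat blk W i (x (Suc (\<sigma> k))) (x (Suc (Suc (\<sigma> k)))))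
       \<longlonglongrightarrow> xinf - (\<Sum>j\<in>UNIV. W $ i $ j *\<^sub>R block blk j 0)"
      unfolding xhat_eq by (intro tendsto_intros x_lim' d0)
    then show ?thesis by (simp add: linear_0[OF linear_block])
  qed
  define \<xi> where "\<xi> i = B i (Q *v xinf) - B i (transpose A *v linf)" for i
  have dir_lim: "(\<lambda>k. direction (Suc (\<sigma> k)) i) \<longlonglongrightarrow> \<xi> i" for i
  proof -
    have "(\<lambda>k. direction (Suc (\<sigma> k)) i) \<longlonglongrightarrow>
       B i (Q *v xinf) - B i (transpose A *v (linf - \<beta> *\<^sub>R (A *v xinf - b))) + P i *v B i 0"
      unfolding direction_def Let_def by (intro tendsto_intros xhat_lim d0 lam_lim)
    then show ?thesis
      by (simp add: \<xi>_def feas linear_0[OF linear_block])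
  qed
  \<comment> \<open>Passing to the limit inside the closed epigraph avoids any discussion of semicontinuity.\<close>
  have epi: "g i (B i xinf) \<le> ereal (gr i v + \<xi> i \<bullet> (v - B i xinf))"
    if v: "v \<in> block_space blk i" "g i v \<noteq> \<infinity>" for i v
  proof -
    let ?y = "\<lambda>k. B i (x (Suc (Suc (\<sigma> k))))"
    let ?e = "\<lambda>k. (?y k, gr i v + direction (Suc (\<sigma> k)) i \<bullet> (v - ?y k))"
    have "?e k \<in> epi_on (block_space blk i) (g i)" for k
    proof -
      have "1 \<le> Suc (\<sigma> k)" by simp
      note opt = ereal_gr[OF block_in_block_space block_optimality(1)[OF this]]
        block_optimality(2)[OF this v]
      show ?thesis
        unfolding epi_on_def mem_Collect_eq case_prod_conv opt(1) ereal_less_eq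
        by (intro conjI block_in_block_space opt(2))
    qed
    moreover have "?e \<longlonglongrightarrow> (B i xinf, gr i v + \<xi> i \<bullet> (v - B i xinf))"
      by (intro tendsto_intros x_lim' dir_lim)
    ultimately have "(B i xinf, gr i v + \<xi> i \<bullet> (v - B i xinf)) \<in> epi_on (block_space blk i) (g i)"
      using g_pcc[of i] closed_sequentially[of "epi_on (block_space blk i) (g i)" ?e]
      unfolding proper_closed_convex_on_def by blast
    then show ?thesis by (simp add: epi_on_def)
  qed
  \<comment> \<open>The limit inequality against any point of finite value already bounds
    \<open>g i\<close> at the limit.\<close>
  have fin: "g i (B i xinf) \<noteq> \<infinity>" for i
  proof -
    obtain v where "v \<in> block_space blk i" "g i v \<noteq> \<infinity>"
      using g_pcc[of i] by (auto simp: proper_closed_convex_on_def proper_on_def)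
    from epi[OF this] show ?thesis by auto
  qed
  have "Fr xinf + linf \<bullet> (A *v y - A *v xinf) \<le> Fr y" if y: "y \<in> dom_F" for y
  proof -
    have "gr i (B i xinf) \<le> gr i (B i y) + \<xi> i \<bullet> B i (y - xinf)" for i
      using epi[OF block_in_block_space[of blk i y]] y ereal_gr[OF block_in_block_space fin[of i]]
      by (simp add: dom_F_def block_diff)
    then have "(\<Sum>i\<in>UNIV. gr i (B i xinf)) \<le> (\<Sum>i\<in>UNIV. gr i (B i y)) + (\<Sum>i\<in>UNIV. \<xi> i \<bullet> B i (y - xinf))"
      by (simp add: sum_mono flip: sum.distrib)
    moreover have "(\<Sum>i\<in>UNIV. \<xi> i \<bullet> B i (y - xinf)) = (H *v xinf) \<bullet> (H *v (y - xinf)) - linf \<bullet> (A *v (y - xinf))"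
    proof -
      have "\<xi> i \<bullet> B i (y - xinf) = (Q *v xinf - transpose A *v linf) \<bullet> B i (y - xinf)" for i
        by (simp only: \<xi>_def inner_block block_block inner_diff_left)
      then have "(\<Sum>i\<in>UNIV. \<xi> i \<bullet> B i (y - xinf)) = (Q *v xinf - transpose A *v linf) \<bullet> (y - xinf)"
        by (simp add: sum_block del: transpose_matrix_vector flip: inner_sum_right)
      then show ?thesis
        by (simp only: inner_diff_left inner_Q inner_transpose_mult)
    qed
    ultimately show ?thesis
      using f_obj_expand[of y xinf] zero_le_power2[of "norm (H *v (y - xinf))"]
      unfolding Fr_def matrix_vector_mult_diff_distrib by linarith
  qed
  then show ?thesis
    using fin feas by (simp add: KKT_iff dom_F_def)
qed

text \<open>A Fejer monotonicity argument: the given KKT point serves only to bound the sequence,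
  after which the Lyapunov function is recentred at a cluster point.\<close>

lemma convergence:
  assumes kkt: "KKT blk Q g A b xs ls"
  shows "\<exists>xinf linf. (\<lambda>k. (x k, lam k)) \<longlonglongrightarrow> (xinf, linf) \<and> KKT blk Q g A b xinf linf"
proof -
  have sq_le: "norm v \<le> sqrt (K / a)" if "a * (norm v)\<^sup>2 \<le> K" "a > 0" for v :: "'s::real_normed_vector" and a K
    using that by (intro real_le_rsqrt) (simp add: field_simps)
  have le1: "lyap xs ls (Suc k) \<le> lyap xs ls 1" for k
    using decseqD[OF lyap_decreasing[OF kkt], of 0 k] by simp
  have x_bound: "norm (x (Suc k) - xs) \<le> sqrt (lyap xs ls 1 / c)" for k
  proof (rule sq_le)
    have "0 \<le> (norm (lam (Suc k) - ls))\<^sup>2 / \<rho>" using \<beta>\<rho> by simp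
    then show "c * (norm (x (Suc k) - xs))\<^sup>2 \<le> lyap xs ls 1"
      using lyap_ge[of "Suc k" ls xs] le1[of k] by linarith
  qed (rule c_pos)
  have l_bound: "norm (lam (Suc k) - ls) \<le> sqrt (lyap xs ls 1 / (1 / \<rho>))" for k
  proof (rule sq_le)
    have "0 \<le> c * (norm (x (Suc k) - xs))\<^sup>2" using c_pos by simp
    then show "1 / \<rho> * (norm (lam (Suc k) - ls))\<^sup>2 \<le> lyap xs ls 1"
      using lyap_ge[of "Suc k" ls xs] le1[of k] by simp
  qed (use \<beta>\<rho> in simp)
  have "bounded (range (\<lambda>k. x (Suc k)))" "bounded (range (\<lambda>k. lam (Suc k)))"
    using x_bound l_bound by (auto simp: bounded_any_center[where a = xs] bounded_any_center[where a = ls] dist_norm norm_minus_commute)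
  then have "bounded (range (\<lambda>k. x (Suc k)) \<times> range (\<lambda>k. lam (Suc k)))"
    by (rule bounded_Times)
  then have "bounded (range (\<lambda>k. (x (Suc k), lam (Suc k))))"
    by (rule bounded_subset) auto
  from bounded_imp_convergent_subsequence[OF this]
  obtain l \<sigma> where \<sigma>: "strict_mono \<sigma>" and lim: "((\<lambda>k. (x (Suc k), lam (Suc k))) \<circ> \<sigma>) \<longlonglongrightarrow> l"
    by blast
  obtain xinf linf where l: "l = (xinf, linf)" by (cases l)
  have x_lim: "(\<lambda>k. x (Suc (\<sigma> k))) \<longlonglongrightarrow> xinf" and lam_lim: "(\<lambda>k. lam (Suc (\<sigma> k))) \<longlonglongrightarrow> linf"
    using tendsto_fst[OF lim] tendsto_snd[OF lim] by (simp_all add: l)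
  have kkt': "KKT blk Q g A b xinf linf"
    by (rule cluster_point_KKT[OF kkt \<sigma> x_lim lam_lim])
  let ?l = "\<lambda>k. lyap xinf linf (Suc k)"
  have "(\<lambda>k. ?l (\<sigma> k)) \<longlonglongrightarrow> (norm (linf - linf))\<^sup>2 / \<rho> + (xinf - xinf) \<bullet> (metric *v (xinf - xinf))"
    unfolding lyap_def qform_def using \<beta>\<rho> by (intro tendsto_intros x_lim lam_lim) auto
  then have sub0: "(\<lambda>k. ?l (\<sigma> k)) \<longlonglongrightarrow> 0" by simp
  \<comment> \<open>One small value along the subsequence suffices, since monotonicity keeps all
    later values below it.\<close>
  have "?l \<longlonglongrightarrow> 0"
  proof (rule LIMSEQ_I)
    fix e :: real assume "e > 0"
    then obtain n where n: "?l (\<sigma> n) < e"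
      using order_tendstoD(2)[OF sub0] by (metis eventually_at_top_linorder order_refl)
    have "?l k < e" if "k \<ge> \<sigma> n" for k
      using decseqD[OF lyap_decreasing[OF kkt'] that] n by linarith
    then show "\<exists>no. \<forall>k\<ge>no. norm (?l k - 0) < e"
      using lyap_nonneg by auto
  qed
  then have "(\<lambda>k. sqrt (?l k / a)) \<longlonglongrightarrow> sqrt (0 / a)" if "a > 0" for a
    by (intro tendsto_intros) (use that in auto)
  then have s0: "(\<lambda>k. sqrt (?l k / a)) \<longlonglongrightarrow> 0" if "a > 0" for a
    using that by simp
  have "(\<lambda>k. x (Suc k) - xinf) \<longlonglongrightarrow> 0"
  proof (rule Lim_null_comparison[OF _ s0[OF c_pos]], intro always_eventually allI sq_le)
    fix k
    have "0 \<le> (norm (lam (Suc k) - linf))\<^sup>2 / \<rho>" using \<beta>\<rho> by simp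
    then show "c * (norm (x (Suc k) - xinf))\<^sup>2 \<le> ?l k"
      using lyap_ge[of "Suc k" linf xinf] by linarith
  qed (rule c_pos)
  moreover have "(\<lambda>k. lam (Suc k) - linf) \<longlonglongrightarrow> 0"
  proof (rule Lim_null_comparison[OF _ s0[of "1 / \<rho>"]], intro always_eventually allI sq_le)
    fix k
    have "0 \<le> c * (norm (x (Suc k) - xinf))\<^sup>2" using c_pos by simp
    then show "1 / \<rho> * (norm (lam (Suc k) - linf))\<^sup>2 \<le> ?l k"
      using lyap_ge[of "Suc k" linf xinf] by simp
  qed (use \<beta>\<rho> in simp_all)
  \<comment> \<open>Limits are insensitive to the index shift that skipped the value at 0.\<close>
  ultimately have "x \<longlonglongrightarrow> xinf" "lam \<longlonglongrightarrow> linf"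
    by (simp_all add: LIM_zero_iff filterlim_sequentially_Suc)
  then show ?thesis
    using kkt' tendsto_Pair by blast
qed

end

end

theorem theorem3p6:
  fixes blk :: "'n::finite \<Rightarrow> 'm::{finite,linorder}"
    and Q :: "real ^ 'n ^ 'n"
    and H :: "real ^ 'n ^ 'p::finite"
    and A :: "real ^ 'n ^ 'q::finite"
    and b :: "real ^ 'q"
    and g :: "'m \<Rightarrow> real ^ 'n \<Rightarrow> ereal"
    and P :: "'m \<Rightarrow> real ^ 'n ^ 'n"
    and W :: "real ^ 'm::{finite,linorder} ^ 'm::{finite,linorder}"
    and u :: "real ^ 'm::{finite,linorder}"
    and \<alpha> \<beta> \<rho> :: real
    and x :: "nat \<Rightarrow> real ^ 'n"
    and lam :: "nat \<Rightarrow> real ^ 'q"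
  assumes Q_psd: "psd Q"
    and Q_fact: "Q = transpose H ** H"
    and g_pcc: "\<And>i. proper_closed_convex_on (block_space blk i) (g i)"
    and KKT_ex: "\<exists>xs ls. KKT blk Q g A b xs ls"
    and P_blk: "\<And>i. block_supported blk i (P i)"
    and P_psd: "\<And>i. psd (P i)"
    and sols_ne: "\<And>k i. k \<ge> 1 \<Longrightarrow>
          subproblem_sols blk Q g A b \<beta> P i (xhat blk W i (x k) (x (Suc k))) (x k) (lam k) \<noteq> {}"
    and W_upper: "\<And>i j. i \<le> j \<Longrightarrow> W $ i $ j = 1"
    and U_sym: "sym_mat (U_mat W u)"
    and gen: "generated blk Q g A b \<beta> \<rho> W P x lam"
    and \<beta>\<rho>: "\<beta> \<ge> \<rho>" "\<rho> > 0"
    and \<alpha>: "\<alpha> \<ge> 1"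
    and P_hat_psd: "psd (P_hat blk H A P W u \<alpha> \<beta>)"
  shows "(\<forall>t\<ge>1. \<forall>xs ls. KKT blk Q g A b xs ls \<longrightarrow>
            (let xbar = (1 / real t) *\<^sub>R (\<Sum>k=1..t. x (Suc k));
                 C = rate_const blk H A P W u \<beta> \<rho> (x 1) xs ls
             in \<bar>F_obj blk Q g xbar - F_obj blk Q g xs\<bar> \<le> ereal (1 / (2 * real t) * C)
                \<and> norm (A *v xbar - b) \<le> 1 / (2 * real t) * C))
       \<and> (\<alpha> > 1 \<and> pd (P_hat blk H A P W u \<alpha> \<beta>) \<longrightarrow>
            (\<exists>xinf linf. (\<lambda>k. (x k, lam k)) \<longlonglongrightarrow> (xinf, linf) \<and> KKT blk Q g A b xinf linf))"
proof -
  interpret hybrid_jacobi_gauss_seidel blk Q H A b g P W u \<alpha> \<beta> \<rho> x lam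
    by unfold_locales fact+
  obtain xs ls where kkt: "KKT blk Q g A b xs ls" using KKT_ex by blast
  show ?thesis
  proof (intro conjI allI impI)
    fix t :: nat and xs ls assume "t \<ge> 1" "KKT blk Q g A b xs ls"
    then show "let xbar = (1 / real t) *\<^sub>R (\<Sum>k=1..t. x (Suc k));
                 C = rate_const blk H A P W u \<beta> \<rho> (x 1) xs ls
             in \<bar>F_obj blk Q g xbar - F_obj blk Q g xs\<bar> \<le> ereal (1 / (2 * real t) * C)
                \<and> norm (A *v xbar - b) \<le> 1 / (2 * real t) * C"
      unfolding Let_def using rate by blast
  next
    assume "\<alpha> > 1 \<and> pd (P_hat blk H A P W u \<alpha> \<beta>)"
    then obtain c where "c > 0" "\<And>v. c * (norm v)\<^sup>2 \<le> qform (P_hat blk H A P W u \<alpha> \<beta>) v"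
      using pd_lower_bound by blast
    from convergence[OF this kkt]
    show "\<exists>xinf linf. (\<lambda>k. (x k, lam k)) \<longlonglongrightarrow> (xinf, linf) \<and> KKT blk Q g A b xinf linf" .
  qed
qed

end
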